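(* Let $n\geq 2$ and $a>0$, and let $$D(a)=\left\{z\in\mathbb{C}^n:\ \left||z_k|^2-|z_n|^2\right|<\frac{1}{(|z_n|^2+1)^{a}}\ \text{ for } k=1,\ldots,n-1\right\}.$$ If $a>\frac{1}{n-1}$, then $$A^2(D(a))=\mathrm{Span}\{z^p:\ p\in\mathbb{N}_0^n,\ |p|<(n-1)a-1\}.$$ Consequently, $$\dim A^2(D(a))=\begin{cases}0 & \text{if } 0<a\leq \frac{1}{n-1},\\[2pt] \binom{n+k}{k} & \text{if } \frac{k+1}{n-1}<a\leq\frac{k+2}{n-1}\ \ (k\in\mathbb{N}_0).\end{cases}$$
   Context: $\mathbb{N}_0$ denotes the nonnegative integers. For a domain $\Omega\subset\mathbb{C}^n$, $A^2(\Omega)$ is the Bergman space: the Hilbert space of holomorphic functions $f$ on $\Omega$ with $\int_\Omega|f|^2\,dV<\infty$, $dV$ being Lebesgue measure on $\mathbb{C}^n$. For $p=(p_1,\ldots,p_n)\in\mathbb{N}_0^n$ and $z\in\mathbb{C}^n$, $|p|=p_1+\cdots+p_n$ and $z^p=z_1^{p_1}\cdots z_n^{p_n}$. *)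

theory Defs
  imports "HOL-Analysis.Analysis" "HOL-Library.Function_Algebras"
begin

definition holomorphic_n :: "(complex ^ 'n \<Rightarrow> complex) \<Rightarrow> (complex ^ 'n) set \<Rightarrow> bool" where
  "holomorphic_n f \<Omega> \<longleftrightarrow> open \<Omega> \<and>
     (\<forall>z\<in>\<Omega>. \<exists>L. (f has_derivative L) (at z) \<and> (\<forall>(c::complex) v. L (c *s v) = c * L v))"

text \<open>Bergman space; functions are normalised to vanish off the domain, so that
  elements of A^2(Omega) correspond one-to-one to HOL functions.\<close>
definition bergman_space :: "(complex ^ 'n) set \<Rightarrow> (complex ^ 'n \<Rightarrow> complex) set" where
  "bergman_space \<Omega> = {f. holomorphic_n f \<Omega> \<and>
      set_integrable lebesgue \<Omega> (\<lambda>z. (cmod (f z))^2) \<and> (\<forall>z. z \<notin> \<Omega> \<longrightarrow> f z = 0)}"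

definition fscale :: "complex \<Rightarrow> ('a \<Rightarrow> complex) \<Rightarrow> ('a \<Rightarrow> complex)" where
  "fscale c f = (\<lambda>z. c * f z)"

abbreviation cspan :: "('a \<Rightarrow> complex) set \<Rightarrow> ('a \<Rightarrow> complex) set" where
  "cspan \<equiv> module.span fscale"

abbreviation cdim :: "('a \<Rightarrow> complex) set \<Rightarrow> nat" where
  "cdim \<equiv> vector_space.dim fscale"

definition monomial_n :: "('n::finite \<Rightarrow> nat) \<Rightarrow> complex ^ 'n \<Rightarrow> complex" where
  "monomial_n p z = (\<Prod>i\<in>UNIV. (z $ i) ^ p i)"

definition mi_length :: "('n::finite \<Rightarrow> nat) \<Rightarrow> nat" where
  "mi_length p = (\<Sum>i\<in>UNIV. p i)"

text \<open>The domain D(a); the distinguished coordinate z_n is the index m.\<close>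
definition domD :: "real \<Rightarrow> 'n::finite \<Rightarrow> (complex ^ 'n) set" where
  "domD a m = {z. \<forall>k. k \<noteq> m \<longrightarrow>
      \<bar>(cmod (z $ k))^2 - (cmod (z $ m))^2\<bar> < 1 / ((cmod (z $ m))^2 + 1) powr a}"

end

(*
  The domain D = D(a) is balanced, invariant under rotating each coordinate separately, and contains a
  neighbourhood of 0. Hence f in A^2(D) is on D the sum of its homogeneous parts f_d(z), the Taylor
  coefficients of l |-> f(l z). Each f_d is a limit of averages of f over rotations by roots of unity:
  near 0 the limit is uniform, so with homogeneity f_d is entire along complex lines, of growth |z|^d, and
  by Liouville polynomial in each coordinate; on D the averages do not increase the L^2 norm, so f_d is in
  L^2(D) by Fatou. Averaging over rotations of single coordinates splits f_d into multiples of monomials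
  that are again in L^2(D). Finally, by Fubini the squared norm of z^p is comparable to the integral of
  (|w|^2 + 1)^(|p| - (n-1)a) over the plane, finite exactly when |p| < (n-1)a - 1: the slice of D over
  z_n = w is a product of annuli of area 2 pi (|w|^2 + 1)^(-a), on which |z_k|^2 is within 1 of |w|^2.
*)
theory Submission
  imports Defs "HOL-Complex_Analysis.Cauchy_Integral_Formula"
begin

section \<open>Lebesgue measure and rotations\<close>

text \<open>The averages are finite sums over N-th roots of unity in place of integrals over the
  circle: their measurability, holomorphy and norm bound are then properties of finite sums, not of
  integrals with a parameter. The price is aliasing, since such an average cannot tell apart
  exponents that are congruent mod N. For f itself the aliased terms lie in a tail of an absolutely
  convergent series and vanish as N grows; for a polynomial of degree below N there are none, so f_d
  splits into monomials exactly, at a fixed N. The obstacle is that D is not a union of polydiscs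
  about 0, so an expansion into monomials valid on all of D cannot be read off from Cauchy's formula
  on polydiscs. This is why the degree is separated before the exponents: the homogeneous series
  needs only the disc that D cuts out of each complex line through 0. Square integrability then
  leaves finitely many degrees, and no convergence in norm has to be discussed. The dimension
  follows from independence of the truncated monomials, tested by a discrete Fourier transform on
  the unit torus, and from a count of exponents.\<close>

lemma prod_Basis_vec:
  "(\<Prod>b\<in>(Basis :: ('a::euclidean_space ^ 'n) set). f b) = (\<Prod>i\<in>UNIV. \<Prod>u\<in>Basis. f (axis i u))"
proof -
  have inj: "inj_on (\<lambda>(i, u). axis i u :: 'a ^ 'n) (UNIV \<times> Basis)"
    by (auto simp: inj_on_def axis_eq_axis)
  have img: "(Basis :: ('a ^ 'n) set) = (\<lambda>(i, u). axis i u) ` (UNIV \<times> Basis)"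
    by (auto simp: Basis_vec_def)
  have "(\<Prod>b\<in>(Basis :: ('a ^ 'n) set). f b) = (\<Prod>x\<in>UNIV \<times> Basis. f (case x of (i, u) \<Rightarrow> axis i u))"
    unfolding img using inj by (simp add: prod.reindex o_def)
  also have "\<dots> = (\<Prod>i\<in>UNIV. \<Prod>u\<in>Basis. f (axis i u))"
    by (simp add: prod.cartesian_product case_prod_beta)
  finally show ?thesis .
qed

lemma measurable_vec_lambda_PiM [measurable]:
  "(\<lambda>f. \<chi> i. f i) \<in> PiM (UNIV :: 'n::finite set) (\<lambda>_. lborel :: 'a::euclidean_space measure) \<rightarrow>\<^sub>M borel"
  unfolding borel_measurable_euclidean_space[where f="\<lambda>f. \<chi> i. f i"]
  by (auto simp: Basis_vec_def inner_axis)

text \<open>Both measures agree on boxes, which determines \<open>lborel\<close>. Writing it as a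
  product measure makes Fubini available coordinate by coordinate, for rotations and for the norms
  of monomials.\<close>

lemma lborel_vec_eq_distr_PiM:
  "(lborel :: ('a::euclidean_space ^ 'n::finite) measure) =
     distr (PiM UNIV (\<lambda>_. lborel)) borel (\<lambda>f. \<chi> i. f i)"
proof (rule lborel_eqI)
  interpret product_sigma_finite "\<lambda>_::'n. lborel :: 'a measure" ..
  fix l u :: "'a ^ 'n" assume le: "\<And>b. b \<in> Basis \<Longrightarrow> l \<bullet> b \<le> u \<bullet> b"
  have le': "l $ i \<bullet> b \<le> u $ i \<bullet> b" if "b \<in> Basis" for i b
    using le[of "axis i b"] that by (simp add: inner_axis axis_in_Basis_iff)
  have vim: "(\<lambda>f. \<chi> i. f i) -` box l u \<inter> space (PiM UNIV (\<lambda>_. lborel :: 'a measure))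
      = PiE UNIV (\<lambda>i. box (l $ i) (u $ i))"
    by (auto simp: space_PiM mem_box Basis_vec_def inner_axis PiE_def Pi_iff)
  have "emeasure (distr (PiM UNIV (\<lambda>_. lborel)) borel (\<lambda>f. \<chi> i. f i)) (box l u)
      = (\<Prod>i\<in>UNIV. emeasure (lborel :: 'a measure) (box (l $ i) (u $ i)))"
    by (subst emeasure_distr) (simp_all only: vim, auto simp: emeasure_PiM)
  also have "\<dots> = (\<Prod>i\<in>UNIV. ennreal (\<Prod>b\<in>Basis. (u $ i - l $ i) \<bullet> b))"
    by (intro prod.cong) (auto simp: emeasure_lborel_box le')
  also have "\<dots> = ennreal (\<Prod>b\<in>Basis. (u - l) \<bullet> b)"
    by (subst prod_ennreal) (auto simp: prod_Basis_vec inner_axis le' inner_diff_left intro!: prod_nonneg)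
  finally show "emeasure (distr (PiM UNIV (\<lambda>_. lborel)) borel (\<lambda>f. \<chi> i. f i)) (box l u)
      = ennreal (\<Prod>b\<in>Basis. (u - l) \<bullet> b)" .
qed simp

section \<open>Invariance of planar and n-dimensional Lebesgue measure under rotations\<close>

definition vec2_to_complex :: "real ^ 2 \<Rightarrow> complex" where
  "vec2_to_complex x = Complex (x $ 1) (x $ 2)"

definition complex_to_vec2 :: "complex \<Rightarrow> real ^ 2" where
  "complex_to_vec2 z = vector [Re z, Im z]"

lemma complex_to_vec2_inverse [simp]: "vec2_to_complex (complex_to_vec2 z) = z"
  and vec2_to_complex_inverse [simp]: "complex_to_vec2 (vec2_to_complex x) = x"
  by (auto simp: vec2_to_complex_def complex_to_vec2_def vec_eq_iff forall_2)

lemma inner_complex_to_vec2: "complex_to_vec2 x \<bullet> complex_to_vec2 y = x \<bullet> y"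
  by (simp add: complex_to_vec2_def inner_vec_def sum_2 inner_complex_def)

lemma linear_vec2_to_complex: "linear vec2_to_complex"
  by (rule linearI) (auto simp: vec2_to_complex_def complex_eq_iff)

lemma vec2_to_complex_borel [measurable]: "vec2_to_complex \<in> borel_measurable borel"
  using linear_vec2_to_complex by (intro borel_measurable_continuous_onI linear_continuous_on)
    (simp add: linear_conv_bounded_linear)

lemma vec2_to_complex_vimage_box:
  "vec2_to_complex -` box l u = box (complex_to_vec2 l) (complex_to_vec2 u)"
  by (auto simp: mem_box_cart complex_to_vec2_def vec2_to_complex_def in_box_complex_iff forall_2)

lemma lborel_eq_distr_vec2_to_complex: "(lborel :: complex measure) = distr lborel borel vec2_to_complex"
proof (rule lborel_eqI)
  fix l u :: complex assume le: "\<And>b. b \<in> Basis \<Longrightarrow> l \<bullet> b \<le> u \<bullet> b"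
  have le': "Re l \<le> Re u" "Im l \<le> Im u"
    using le[of 1] le[of \<i>] by (auto simp: Basis_complex_def inner_complex_def)
  have le'': "complex_to_vec2 l $ i \<le> complex_to_vec2 u $ i" for i
    using exhaust_2[of i] le' by (auto simp: complex_to_vec2_def)
  have "emeasure (distr lborel borel vec2_to_complex) (box l u)
     = emeasure lborel (box (complex_to_vec2 l) (complex_to_vec2 u))"
    by (subst emeasure_distr) (auto simp: vec2_to_complex_vimage_box)
  also have "\<dots> = ennreal (\<Prod>b\<in>Basis. (complex_to_vec2 u - complex_to_vec2 l) \<bullet> b)"
    by (rule emeasure_lborel_box) (auto simp: Basis_vec_def inner_axis le'')
  also have "(\<Prod>b\<in>Basis. (complex_to_vec2 u - complex_to_vec2 l) \<bullet> b) = (\<Prod>b\<in>Basis. (u - l) \<bullet> b)"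
    by (simp add: prod_Basis_vec inner_axis complex_to_vec2_def UNIV_2
        Basis_complex_def inner_complex_def)
  finally show "emeasure (distr lborel borel vec2_to_complex) (box l u) = ennreal (\<Prod>b\<in>Basis. (u - l) \<bullet> b)" .
qed simp

text \<open>Multiplication by a unit is orthogonal. The claim is transported to
  \<open>real ^ 2\<close>, where invariance of Lebesgue measure under orthogonal maps
  applies.\<close>

lemma emeasure_lborel_mult_unit_vimage:
  fixes u :: complex
  assumes u: "cmod u = 1"
  shows "emeasure lborel ((*) u -` box l r) = emeasure lborel (box l r)"
proof -
  \<comment> \<open>The inverse rotation: the invariance theorem speaks of images, and the preimage
    under multiplication by \<open>u\<close> is the image under multiplication by
    \<open>inverse u\<close>.\<close>
  define T where "T = (\<lambda>x. complex_to_vec2 (inverse u * vec2_to_complex x))"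
  have u0: "u \<noteq> 0" using u by auto
  have lin: "linear T"
    by (rule linearI)
      (auto simp: T_def complex_to_vec2_def vec2_to_complex_def vec_eq_iff forall_2 algebra_simps
        add_divide_distrib)
  have inner_mult: "(v * x) \<bullet> (v * y) = x \<bullet> y" if "cmod v = 1" for v x y :: complex
  proof -
    have "(v * x) \<bullet> (v * y) = ((Re v)\<^sup>2 + (Im v)\<^sup>2) * (x \<bullet> y)"
      by (simp add: inner_complex_def power2_eq_square algebra_simps)
    also have "(Re v)\<^sup>2 + (Im v)\<^sup>2 = 1"
      using that cmod_power2[of v] by simp
    finally show ?thesis by simp
  qed
  have T: "orthogonal_transformation T"
    unfolding orthogonal_transformation_def
  proof safe
    show "T x \<bullet> T y = x \<bullet> y" for x y
      using inner_complex_to_vec2[of "vec2_to_complex x" "vec2_to_complex y"]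
      by (simp add: T_def inner_complex_to_vec2 inner_mult norm_inverse u)
  qed (rule lin)
  define S where "S = box (complex_to_vec2 l) (complex_to_vec2 r)"
  have S: "x \<in> S \<longleftrightarrow> vec2_to_complex x \<in> box l r" for x
    unfolding S_def vec2_to_complex_vimage_box[symmetric] by simp
  have eq: "vec2_to_complex -` ((*) u -` box l r) = T ` S"
  proof (intro equalityI subsetI)
    fix x assume "x \<in> vec2_to_complex -` ((*) u -` box l r)"
    then have "u * vec2_to_complex x \<in> box l r" by simp
    then have "complex_to_vec2 (u * vec2_to_complex x) \<in> S" by (simp add: S)
    moreover have "T (complex_to_vec2 (u * vec2_to_complex x)) = x"
      using u0 by (simp add: T_def mult.assoc[symmetric])
    ultimately show "x \<in> T ` S" by (metis imageI)
  next
    fix x assume "x \<in> T ` S"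
    then obtain y where "x = T y" "y \<in> S" by auto
    then show "x \<in> vec2_to_complex -` ((*) u -` box l r)"
      using u0 by (simp add: T_def S mult.assoc[symmetric])
  qed
  have meas: "(*) u -` box l r \<in> sets borel"
    by (intro borel_open open_vimage) (auto intro!: continuous_intros)
  have "T ` S \<in> sets borel"
    using measurable_sets[OF vec2_to_complex_borel meas] eq by simp
  have SL: "S \<in> lmeasurable" by (simp add: S_def)
  have TL: "T ` S \<in> lmeasurable" and TM: "measure lebesgue (T ` S) = measure lebesgue S"
    using measurable_orthogonal_image[OF T SL] measure_orthogonal_image[OF T SL] by auto
  have "emeasure lborel ((*) u -` box l r) = emeasure lborel (T ` S)"
    using meas by (subst lborel_eq_distr_vec2_to_complex, subst emeasure_distr) (auto simp: eq)
  also have "\<dots> = emeasure lebesgue (T ` S)"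
    using \<open>T ` S \<in> sets borel\<close> by simp
  also have "\<dots> = emeasure lebesgue S"
    using TM SL TL by (simp add: emeasure_eq_measure2)
  also have "\<dots> = emeasure lborel (box l r)"
    by (subst lborel_eq_distr_vec2_to_complex, subst emeasure_distr)
       (auto simp: S_def vec2_to_complex_vimage_box)
  finally show ?thesis .
qed

definition rot :: "('n \<Rightarrow> complex) \<Rightarrow> complex ^ 'n \<Rightarrow> complex ^ 'n" where
  "rot u z = (\<chi> i. u i * z $ i)"

lemma rot_nth [simp]: "rot u z $ i = u i * z $ i"
  by (simp add: rot_def)

lemma linear_rot: "linear (rot u)"
  by (rule linearI) (auto simp: vec_eq_iff algebra_simps)

lemma rot_borel [measurable]: "(rot u :: complex ^ 'n::finite \<Rightarrow> _) \<in> borel_measurable borel"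
  using linear_rot by (intro borel_measurable_continuous_onI linear_continuous_on)
    (simp add: linear_conv_bounded_linear)

text \<open>The preimage of a box is in general no box, but it is still a product of planar sets,
  namely rotated rectangles. So its measure factors, and each factor is settled in the
  plane.\<close>

lemma distr_lborel_rot:
  fixes u :: "'n::finite \<Rightarrow> complex"
  assumes u: "\<And>i. cmod (u i) = 1"
  shows "distr lborel borel (rot u) = lborel"
proof (rule lborel_eqI[symmetric])
  interpret product_sigma_finite "\<lambda>_::'n. lborel :: complex measure" ..
  fix l r :: "complex ^ 'n" assume le: "\<And>b. b \<in> Basis \<Longrightarrow> l \<bullet> b \<le> r \<bullet> b"
  have meas: "(*) (u i) -` box (l $ i) (r $ i) \<in> sets borel" for i
    by (intro borel_open open_vimage) (auto intro!: continuous_intros)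
  have vim: "(\<lambda>f. \<chi> i. f i) -` box l r \<inter> space (PiM UNIV (\<lambda>_. lborel :: complex measure))
      = PiE UNIV (\<lambda>i. box (l $ i) (r $ i))"
    by (auto simp: space_PiM mem_box Basis_vec_def inner_axis PiE_def Pi_iff)
  have vim': "(\<lambda>f. \<chi> i. f i) -` (rot u -` box l r) \<inter> space (PiM UNIV (\<lambda>_. lborel :: complex measure))
      = PiE UNIV (\<lambda>i. (*) (u i) -` box (l $ i) (r $ i))"
    by (auto simp: space_PiM mem_box Basis_vec_def inner_axis PiE_def Pi_iff)
  have "rot u -` box l r \<inter> space borel \<in> sets borel"
    by (rule measurable_sets[of _ borel borel]) auto
  then have "emeasure (distr lborel borel (rot u)) (box l r)
    = (\<Prod>i\<in>UNIV. emeasure (lborel :: complex measure) ((*) (u i) -` box (l $ i) (r $ i)))"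
    by (subst emeasure_distr, simp_all, subst lborel_vec_eq_distr_PiM, subst emeasure_distr)
       (simp_all only: vim', auto simp: emeasure_PiM meas)
  also have "\<dots> = (\<Prod>i\<in>UNIV. emeasure (lborel :: complex measure) (box (l $ i) (r $ i)))"
    by (intro prod.cong) (auto simp: emeasure_lborel_mult_unit_vimage u)
  also have "\<dots> = emeasure lborel (box l r)"
    by (subst lborel_vec_eq_distr_PiM, subst emeasure_distr)
       (simp_all only: vim, auto simp: emeasure_PiM)
  also have "\<dots> = ennreal (\<Prod>b\<in>Basis. (r - l) \<bullet> b)"
    using le by (rule emeasure_lborel_box)
  finally show "emeasure (distr lborel borel (rot u)) (box l r) = ennreal (\<Prod>b\<in>Basis. (r - l) \<bullet> b)" .
qed simp


section \<open>Square integrability of monomials\<close>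

lemma emeasure_norm_sq_less:
  assumes "0 \<le> t"
  shows "emeasure lborel {z::complex. (cmod z)\<^sup>2 < t} = ennreal (pi * t)"
proof -
  have "(cmod z)\<^sup>2 < t \<longleftrightarrow> cmod z < sqrt t" for z :: complex
    using real_sqrt_less_iff[of "(cmod z)\<^sup>2" t, symmetric] by (simp only: real_sqrt_abs abs_norm_cancel)
  then have e: "{z::complex. (cmod z)\<^sup>2 < t} = ball 0 (sqrt t)"
    unfolding set_eq_iff mem_ball dist_0_norm mem_Collect_eq by blast
  show ?thesis
    unfolding e using assms by (simp add: emeasure_ball unit_ball_vol_2)
qed

lemma emeasure_norm_sq_le:
  assumes "0 \<le> t"
  shows "emeasure lborel {z::complex. (cmod z)\<^sup>2 \<le> t} = ennreal (pi * t)"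
proof -
  have "(cmod z)\<^sup>2 \<le> t \<longleftrightarrow> cmod z \<le> sqrt t" for z :: complex
    using real_sqrt_le_iff[of "(cmod z)\<^sup>2" t, symmetric] by (simp only: real_sqrt_abs abs_norm_cancel)
  then have e: "{z::complex. (cmod z)\<^sup>2 \<le> t} = cball 0 (sqrt t)"
    unfolding set_eq_iff mem_cball dist_0_norm mem_Collect_eq by blast
  show ?thesis
    unfolding e using assms by (simp add: emeasure_cball unit_ball_vol_2)
qed

lemma norm_sq_annulus_borel [measurable]:
  "{z::complex. s \<le> (cmod z)\<^sup>2 \<and> (cmod z)\<^sup>2 < t} \<in> sets borel"
  "{z::complex. s < (cmod z)\<^sup>2 \<and> (cmod z)\<^sup>2 < t} \<in> sets borel"
  by measurable

text \<open>Measured in |z|^2 rather than in the radius, planar area is linear: the area of an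
  annulus depends only on its width, not on its position.\<close>

lemma emeasure_half_open_annulus:
  assumes "0 \<le> s" "s \<le> t"
  shows "emeasure lborel {z::complex. s \<le> (cmod z)\<^sup>2 \<and> (cmod z)\<^sup>2 < t} = ennreal (pi * (t - s))"
proof -
  have "{z::complex. s \<le> (cmod z)\<^sup>2 \<and> (cmod z)\<^sup>2 < t} = {z. (cmod z)\<^sup>2 < t} - {z. (cmod z)\<^sup>2 < s}"
    by auto
  also have "emeasure lborel \<dots> = emeasure lborel {z::complex. (cmod z)\<^sup>2 < t} - emeasure lborel {z::complex. (cmod z)\<^sup>2 < s}"
    using assms by (intro emeasure_Diff) (auto simp: emeasure_norm_sq_less)
  also have "\<dots> = ennreal (pi * (t - s))"
    using assms by (simp add: emeasure_norm_sq_less ennreal_minus right_diff_distrib)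
  finally show ?thesis .
qed

lemma emeasure_open_annulus:
  assumes "0 \<le> s" "s \<le> t"
  shows "emeasure lborel {z::complex. s < (cmod z)\<^sup>2 \<and> (cmod z)\<^sup>2 < t} = ennreal (pi * (t - s))"
proof (cases "s = t")
  case False
  have "{z::complex. s < (cmod z)\<^sup>2 \<and> (cmod z)\<^sup>2 < t} = {z. (cmod z)\<^sup>2 < t} - {z. (cmod z)\<^sup>2 \<le> s}"
    by auto
  also have "emeasure lborel \<dots> = emeasure lborel {z::complex. (cmod z)\<^sup>2 < t} - emeasure lborel {z::complex. (cmod z)\<^sup>2 \<le> s}"
    using assms False by (intro emeasure_Diff) (auto simp: emeasure_norm_sq_le)
  also have "\<dots> = ennreal (pi * (t - s))"
    using assms by (simp add: emeasure_norm_sq_less emeasure_norm_sq_le ennreal_minus right_diff_distrib)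
  finally show ?thesis .
next
  case True
  then have e: "{z::complex. s < (cmod z)\<^sup>2 \<and> (cmod z)\<^sup>2 < t} = {}" by auto
  show ?thesis unfolding e using True by simp
qed

text \<open>For \<open>w \<le> r\<close> the set is a true annulus. Otherwise the inner circle has
  disappeared, the set lies in a disc of area pi (r + w), and r < w keeps this below 2 pi w.\<close>

lemma emeasure_annulus_about:
  assumes "0 \<le> r" "0 \<le> w"
  shows "emeasure lborel {z::complex. \<bar>(cmod z)\<^sup>2 - r\<bar> < w} \<le> ennreal (2 * pi * w)"
    and "w \<le> r \<Longrightarrow> emeasure lborel {z::complex. \<bar>(cmod z)\<^sup>2 - r\<bar> < w} = ennreal (2 * pi * w)"
proof -
  have eq: "{z::complex. \<bar>(cmod z)\<^sup>2 - r\<bar> < w} = {z. r - w < (cmod z)\<^sup>2 \<and> (cmod z)\<^sup>2 < r + w}"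
    by auto
  show *: "emeasure lborel {z::complex. \<bar>(cmod z)\<^sup>2 - r\<bar> < w} = ennreal (2 * pi * w)" if "w \<le> r"
    unfolding eq using assms that by (subst emeasure_open_annulus) (auto simp: algebra_simps)
  show "emeasure lborel {z::complex. \<bar>(cmod z)\<^sup>2 - r\<bar> < w} \<le> ennreal (2 * pi * w)"
  proof (cases "w \<le> r")
    case False
    have "emeasure lborel {z::complex. \<bar>(cmod z)\<^sup>2 - r\<bar> < w} \<le> emeasure lborel {z::complex. (cmod z)\<^sup>2 < r + w}"
      by (intro emeasure_mono) auto
    also have "\<dots> = ennreal (pi * (r + w))" using assms by (intro emeasure_norm_sq_less) auto
    also have "\<dots> \<le> ennreal (2 * pi * w)"
      using False by (intro ennreal_leI) (simp add: algebra_simps)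
    finally show ?thesis .
  qed (simp add: *)
qed

text \<open>The annuli k \<le> |z|^2 < k + 1 all have area pi, so radial integrals compare to series.\<close>

lemma nn_integral_radial_finite:
  assumes s: "s < -1"
  shows "(\<integral>\<^sup>+z. ennreal (((cmod z)\<^sup>2 + 1) powr s) \<partial>(lborel :: complex measure)) < \<infinity>"
proof -
  define A where "A = (\<lambda>k::nat. {z::complex. real k \<le> (cmod z)\<^sup>2 \<and> (cmod z)\<^sup>2 < real k + 1})"
  have [measurable]: "A k \<in> sets borel" for k by (simp add: A_def norm_sq_annulus_borel)
  have "(\<integral>\<^sup>+z. ennreal (((cmod z)\<^sup>2 + 1) powr s) \<partial>(lborel :: complex measure))
     \<le> (\<integral>\<^sup>+z. (\<Sum>k. ennreal (real (Suc k) powr s) * indicator (A k) z) \<partial>lborel)"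
  proof (intro nn_integral_mono)
    fix z :: complex
    define k where "k = nat \<lfloor>(cmod z)\<^sup>2\<rfloor>"
    have k: "real k \<le> (cmod z)\<^sup>2" "(cmod z)\<^sup>2 < real k + 1"
      unfolding k_def by (auto simp: of_nat_nat of_int_floor_le)
    have "ennreal (((cmod z)\<^sup>2 + 1) powr s) \<le> ennreal (real (Suc k) powr s) * indicator (A k) z"
      using k s by (auto simp: A_def intro!: ennreal_leI powr_mono2')
    also have "\<dots> \<le> (\<Sum>k. ennreal (real (Suc k) powr s) * indicator (A k) z)"
      using sum_le_suminf[of "\<lambda>k. ennreal (real (Suc k) powr s) * indicator (A k) z" "{k}"]
      by (simp only: sum.insert sum.empty summableI finite.intros empty_iff simp_thms add_0_right zero_le)
    finally show "ennreal (((cmod z)\<^sup>2 + 1) powr s) \<le> \<dots>" .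
  qed
  also have "\<dots> = (\<Sum>k. \<integral>\<^sup>+z. ennreal (real (Suc k) powr s) * indicator (A k) z \<partial>lborel)"
    by (intro nn_integral_suminf) measurable
  also have "\<dots> = (\<Sum>k. ennreal (real (Suc k) powr s * pi))"
    by (simp add: nn_integral_cmult_indicator A_def emeasure_half_open_annulus ennreal_mult')
  also have "\<dots> < \<infinity>"
  proof -
    have "summable (\<lambda>n. real n powr s)" using s by (simp add: summable_real_powr_iff)
    then have "summable (\<lambda>n. real (Suc n) powr s * pi)"
      by (intro summable_mult2) (subst summable_Suc_iff)
    then show ?thesis
      by (subst suminf_ennreal2) auto
  qed
  finally show ?thesis .
qed

text \<open>Comparison with the harmonic series, so the borderline exponent -1 already diverges. The
  cut-off at |z|^2 = 2 is the range in which the lower bound for the slices holds, and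
  \<open>c\<close> absorbs the constants lost there.\<close>

lemma nn_integral_radial_infinite:
  assumes s: "-1 \<le> s" and c: "0 < c"
  shows "(\<integral>\<^sup>+z. ennreal (c * ((cmod z)\<^sup>2 + 1) powr s) * indicator {z. 2 \<le> (cmod z)\<^sup>2} z \<partial>(lborel :: complex measure)) = \<infinity>"
proof -
  \<comment> \<open>The annuli start at |z|^2 = 2. On \<open>A k\<close> one has |z|^2 + 1 < k + 4,
    which is the origin of the terms 1 / (k + 4).\<close>
  define A where "A = (\<lambda>k::nat. {z::complex. real (k+2) \<le> (cmod z)\<^sup>2 \<and> (cmod z)\<^sup>2 < real (k+2) + 1})"
  have [measurable]: "A k \<in> sets borel" for k by (simp add: A_def norm_sq_annulus_borel)
  have "\<not> summable (\<lambda>n. c * inverse (real (n + 4)) * pi)"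
  proof
    assume "summable (\<lambda>n. c * inverse (real (n + 4)) * pi)"
    then have "summable (\<lambda>n. inverse (c * pi) * (c * inverse (real (n + 4)) * pi))"
      by (rule summable_mult)
    then have "summable (\<lambda>n. inverse (real (n + 4)))"
      using c by (simp add: field_simps)
    then have "summable (\<lambda>n. inverse (real n))"
      by (subst (asm) summable_iff_shift)
    then show False
      using not_summable_harmonic[where 'a=real] by simp
  qed
  then have "\<infinity> = (\<Sum>k. ennreal (c * inverse (real (k + 4)) * pi))"
    using summable_suminf_not_top[of "\<lambda>k. c * inverse (real (k + 4)) * pi"] c by fastforce
  also have "\<dots> = (\<Sum>k. \<integral>\<^sup>+z. ennreal (c * inverse (real (k + 4))) * indicator (A k) z \<partial>lborel)"
    using c by (simp add: nn_integral_cmult_indicator A_def emeasure_half_open_annulus ennreal_mult')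
  also have "\<dots> = (\<integral>\<^sup>+z. (\<Sum>k. ennreal (c * inverse (real (k + 4))) * indicator (A k) z) \<partial>lborel)"
    by (intro nn_integral_suminf[symmetric]) measurable
  also have "\<dots> \<le> (\<integral>\<^sup>+z. ennreal (c * ((cmod z)\<^sup>2 + 1) powr s) * indicator {z. 2 \<le> (cmod z)\<^sup>2} z \<partial>(lborel :: complex measure))"
  proof (intro nn_integral_mono)
    fix z :: complex
    show "(\<Sum>k. ennreal (c * inverse (real (k + 4))) * indicator (A k) z)
       \<le> ennreal (c * ((cmod z)\<^sup>2 + 1) powr s) * indicator {z. 2 \<le> (cmod z)\<^sup>2} z"
    proof (cases "2 \<le> (cmod z)\<^sup>2")
      case True
      define k where "k = nat \<lfloor>(cmod z)\<^sup>2\<rfloor> - 2"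
      have k: "real (k + 2) \<le> (cmod z)\<^sup>2" "(cmod z)\<^sup>2 < real (k + 2) + 1"
        unfolding k_def using True by linarith+
      have only: "z \<notin> A j" if "j \<noteq> k" for j
        using k that unfolding A_def by (auto simp: not_less)
      have "(\<Sum>k. ennreal (c * inverse (real (k + 4))) * indicator (A k) z)
        = (\<Sum>k\<in>{k}. ennreal (c * inverse (real (k + 4))) * indicator (A k) z)"
        by (intro suminf_finite) (auto simp: only)
      also have "\<dots> = ennreal (c * inverse (real (k + 4)))"
        using k by (simp add: A_def)
      also have "\<dots> \<le> ennreal (c * ((cmod z)\<^sup>2 + 1) powr s)"
      proof (intro ennreal_leI mult_left_mono)
        have "inverse (real (k + 4)) \<le> inverse ((cmod z)\<^sup>2 + 1)"
          using k by (intro le_imp_inverse_le) (auto intro: add_nonneg_pos)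
        also have "\<dots> = ((cmod z)\<^sup>2 + 1) powr (-1)"
          by (simp add: powr_minus add_nonneg_nonneg)
        also have "\<dots> \<le> ((cmod z)\<^sup>2 + 1) powr s"
          using s by (intro powr_mono) auto
        finally show "inverse (real (k + 4)) \<le> ((cmod z)\<^sup>2 + 1) powr s" .
      qed (use c in auto)
      finally show ?thesis using True by simp
    next
      case False
      then have "z \<notin> A j" for j by (auto simp: A_def)
      then show ?thesis by simp
    qed
  qed
  finally show ?thesis by (simp add: top.extremum_unique)
qed


text \<open>Valued in \<open>ennreal\<close>, so it makes sense before finiteness is known. The
  indicator makes values off \<open>D\<close> irrelevant, so that a monomial and its truncation to
  \<open>D\<close> have the same integral.\<close>

definition sq_integral :: "(complex ^ 'n::finite) set \<Rightarrow> (complex ^ 'n \<Rightarrow> complex) \<Rightarrow> ennreal" where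
  "sq_integral D f = (\<integral>\<^sup>+z. ennreal ((cmod (f z))\<^sup>2) * indicator D z \<partial>lborel)"

lemma open_domD: "open (domD a (m :: 'n::finite))"
proof -
  have "domD a m = (\<Inter>k\<in>-{m}. {z :: complex ^ 'n. \<bar>(cmod (z $ k))\<^sup>2 - (cmod (z $ m))\<^sup>2\<bar> <
      1 / ((cmod (z $ m))\<^sup>2 + 1) powr a})"
    by (auto simp: domD_def)
  also have "open \<dots>"
    by (intro open_INT open_Collect_less ballI continuous_intros)
       (auto simp: add_nonneg_eq_0_iff)
  finally show ?thesis .
qed

lemma domD_borel [measurable]: "domD a m \<in> sets borel"
  using open_domD by (rule borel_open)

lemma norm_monomial_n_sq: "(cmod (monomial_n p z))\<^sup>2 = (\<Prod>i\<in>UNIV. ((cmod (z $ i))\<^sup>2) ^ p i)"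
  by (simp add: monomial_n_def prod_norm[symmetric] norm_power prod_power_distrib power_mult[symmetric] mult.commute)

lemma monomial_n_borel [measurable]: "monomial_n p \<in> borel_measurable borel"
  unfolding monomial_n_def
  by (intro borel_measurable_continuous_onI continuous_intros)

text \<open>The contribution of one coordinate z_k with k distinct from \<open>m\<close>, once
  |z_m|^2 = r is fixed. It depends on z_m through r only.\<close>

definition slice_integral :: "real \<Rightarrow> nat \<Rightarrow> real \<Rightarrow> ennreal" where
  "slice_integral a q r = (\<integral>\<^sup>+z. ennreal (((cmod z)\<^sup>2) ^ q) *
     indicator {z. \<bar>(cmod z)\<^sup>2 - r\<bar> < 1 / (r + 1) powr a} z \<partial>(lborel :: complex measure))"

text \<open>The conditions defining the domain tie each z_k to z_m alone. Once z_m = w is fixed they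
  are independent of each other, so the indicator factors over k and the inner integral is a
  product.\<close>

lemma sq_integral_monomial_n:
  "sq_integral (domD a (m :: 'n::finite)) (monomial_n p) =
     (\<integral>\<^sup>+w. ennreal (((cmod w)\<^sup>2) ^ p m) *
        (\<Prod>k\<in>UNIV-{m}. slice_integral a (p k) ((cmod w)\<^sup>2)) \<partial>lborel)"
proof -
  interpret product_sigma_finite "\<lambda>_::'n. lborel :: complex measure" ..
  define F where "F = (\<lambda>z :: complex ^ 'n. ennreal ((cmod (monomial_n p z))\<^sup>2) * indicator (domD a m) z)"
  have [measurable]: "F \<in> borel_measurable borel"
    unfolding F_def by measurable
  define G where "G = (\<lambda>w k z. ennreal (((cmod z)\<^sup>2) ^ p k) *
     indicator {z. \<bar>(cmod z)\<^sup>2 - (cmod w)\<^sup>2\<bar> < 1 / ((cmod w)\<^sup>2 + 1) powr a} (z::complex) :: ennreal)"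
  have ins: "insert m (UNIV - {m}) = (UNIV :: 'n set)" by auto
  have "sq_integral (domD a m) (monomial_n p) = (\<integral>\<^sup>+f. F (\<chi> i. f i) \<partial>PiM UNIV (\<lambda>_. lborel))"
    unfolding sq_integral_def F_def[symmetric]
    by (subst lborel_vec_eq_distr_PiM, subst nn_integral_distr) auto
  also have "\<dots> = (\<integral>\<^sup>+w. (\<integral>\<^sup>+f. F (\<chi> i. (f(m := w)) i) \<partial>PiM (UNIV - {m}) (\<lambda>_. lborel)) \<partial>lborel)"
    using product_nn_integral_insert_rev[of "UNIV - {m}" m "\<lambda>f. F (\<chi> i. f i)"] by (simp add: ins)
  also have "\<dots> = (\<integral>\<^sup>+w. (\<integral>\<^sup>+f. ennreal (((cmod w)\<^sup>2) ^ p m) * (\<Prod>k\<in>UNIV-{m}. G w k (f k)) \<partial>PiM (UNIV - {m}) (\<lambda>_. lborel)) \<partial>lborel)"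
  proof (intro nn_integral_cong)
    fix w and f :: "'n \<Rightarrow> complex"
    define S where "S = {z. \<bar>(cmod z)\<^sup>2 - (cmod w)\<^sup>2\<bar> < 1 / ((cmod w)\<^sup>2 + 1) powr a}"
    have 1: "ennreal ((cmod (monomial_n p (\<chi> i. (f(m := w)) i)))\<^sup>2)
      = ennreal (((cmod w)\<^sup>2) ^ p m) * (\<Prod>k\<in>UNIV-{m}. ennreal (((cmod (f k))\<^sup>2) ^ p k))"
      unfolding norm_monomial_n_sq
      by (subst ins[symmetric], subst prod.insert) (simp_all add: ennreal_mult' prod_nonneg prod_ennreal)
    have 2: "(indicator (domD a m) (\<chi> i. (f(m := w)) i) :: ennreal) = (\<Prod>k\<in>UNIV-{m}. indicator S (f k))"
    proof (cases "\<forall>k\<in>UNIV-{m}. f k \<in> S")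
      case True
      then show ?thesis by (simp add: domD_def S_def)
    next
      case False
      then obtain k where k: "k \<noteq> m" "f k \<notin> S" by auto
      then have "(\<Prod>k\<in>UNIV-{m}. indicator S (f k)) = (0::ennreal)"
        by (intro prod_zero bexI[of _ k]) auto
      with k show ?thesis by (auto simp: domD_def S_def indicator_def)
    qed
    show "F (\<chi> i. (f(m := w)) i) = ennreal (((cmod w)\<^sup>2) ^ p m) * (\<Prod>k\<in>UNIV-{m}. G w k (f k))"
      unfolding F_def 1 2 G_def S_def[symmetric] by (simp add: prod.distrib mult.assoc)
  qed
  also have "\<dots> = (\<integral>\<^sup>+w. ennreal (((cmod w)\<^sup>2) ^ p m) *
        (\<Prod>k\<in>UNIV-{m}. slice_integral a (p k) ((cmod w)\<^sup>2)) \<partial>lborel)"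
  proof (intro nn_integral_cong)
    fix w :: complex
    have [measurable]: "G w k \<in> borel_measurable borel" for k
      unfolding G_def by measurable
    have "(\<integral>\<^sup>+f. ennreal (((cmod w)\<^sup>2) ^ p m) * (\<Prod>k\<in>UNIV-{m}. G w k (f k)) \<partial>PiM (UNIV - {m}) (\<lambda>_. lborel))
      = ennreal (((cmod w)\<^sup>2) ^ p m) * (\<integral>\<^sup>+f. (\<Prod>k\<in>UNIV-{m}. G w k (f k)) \<partial>PiM (UNIV - {m}) (\<lambda>_. lborel))"
      by (rule nn_integral_cmult) measurable
    also have "(\<integral>\<^sup>+f. (\<Prod>k\<in>UNIV-{m}. G w k (f k)) \<partial>PiM (UNIV - {m}) (\<lambda>_. lborel))
      = (\<Prod>k\<in>UNIV-{m}. slice_integral a (p k) ((cmod w)\<^sup>2))"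
      by (subst product_nn_integral_prod) (simp_all add: slice_integral_def, simp add: G_def)
    finally show "(\<integral>\<^sup>+f. ennreal (((cmod w)\<^sup>2) ^ p m) * (\<Prod>k\<in>UNIV-{m}. G w k (f k)) \<partial>PiM (UNIV - {m}) (\<lambda>_. lborel))
      = ennreal (((cmod w)\<^sup>2) ^ p m) * (\<Prod>k\<in>UNIV-{m}. slice_integral a (p k) ((cmod w)\<^sup>2))" .
  qed
  finally show ?thesis .
qed

lemma one_div_powr_le_one: "0 < a \<Longrightarrow> 0 \<le> r \<Longrightarrow> 1 / (r + 1) powr a \<le> (1::real)"
  by (auto simp: divide_simps intro!: ge_one_powr_ge_zero)

lemma prod_mono_ennreal:
  fixes f g :: "'a \<Rightarrow> ennreal"
  assumes "\<And>i. i \<in> A \<Longrightarrow> f i \<le> g i"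
  shows "prod f A \<le> prod g A"
  using assms by (induction A rule: infinite_finite_induct) (auto intro!: mult_mono)

lemma slice_integral_upper:
  assumes a: "0 < a" and r: "0 \<le> r"
  shows "slice_integral a q r \<le> ennreal ((r + 1) ^ q * (2 * pi * (r + 1) powr (-a)))"
proof -
  have "slice_integral a q r \<le> (\<integral>\<^sup>+z. ennreal ((r + 1) ^ q) *
     indicator {z. \<bar>(cmod z)\<^sup>2 - r\<bar> < 1 / (r + 1) powr a} z \<partial>(lborel :: complex measure))"
    unfolding slice_integral_def
  proof (intro nn_integral_mono)
    fix z :: complex
    show "ennreal (((cmod z)\<^sup>2) ^ q) * indicator {z. \<bar>(cmod z)\<^sup>2 - r\<bar> < 1 / (r + 1) powr a} z
      \<le> ennreal ((r + 1) ^ q) * indicator {z. \<bar>(cmod z)\<^sup>2 - r\<bar> < 1 / (r + 1) powr a} z"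
      using one_div_powr_le_one[OF a r]
      by (auto simp: indicator_def intro!: ennreal_leI power_mono)
  qed
  also have "\<dots> = ennreal ((r + 1) ^ q) * emeasure lborel {z::complex. \<bar>(cmod z)\<^sup>2 - r\<bar> < 1 / (r + 1) powr a}"
    by (rule nn_integral_cmult_indicator) measurable
  also have "\<dots> \<le> ennreal ((r + 1) ^ q) * ennreal (2 * pi * (1 / (r + 1) powr a))"
    using r by (intro mult_left_mono emeasure_annulus_about) auto
  also have "\<dots> = ennreal ((r + 1) ^ q * (2 * pi * (r + 1) powr (-a)))"
    using r by (simp add: ennreal_mult' powr_minus divide_inverse)
  finally show ?thesis .
qed

text \<open>The factor 1/3 and the bound on \<open>r\<close> belong together: on the slice |z|^2 > r
  - 1, and r - 1 is at least (r + 1)/3 exactly when \<open>2 \<le> r\<close>. Expressing this bound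
  in powers of r + 1, like the upper one, lets one exponent computation serve both.\<close>

lemma slice_integral_lower:
  assumes a: "0 < a" and r: "2 \<le> r"
  shows "ennreal (((1/3) * (r + 1)) ^ q * (2 * pi * (r + 1) powr (-a))) \<le> slice_integral a q r"
proof -
  have w: "1 / (r + 1) powr a \<le> 1" using one_div_powr_le_one[of a r] a r by auto
  have "ennreal (((1/3) * (r + 1)) ^ q * (2 * pi * (r + 1) powr (-a)))
     = ennreal (((1/3) * (r + 1)) ^ q) * ennreal (2 * pi * (1 / (r + 1) powr a))"
    using r by (subst ennreal_mult'[symmetric]) (simp_all add: powr_minus_divide)
  also have "\<dots> = ennreal (((1/3) * (r + 1)) ^ q) * emeasure lborel {z::complex. \<bar>(cmod z)\<^sup>2 - r\<bar> < 1 / (r + 1) powr a}"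
    using r order_trans[OF w, of r] by (subst emeasure_annulus_about(2)) simp_all
  also have "\<dots> = (\<integral>\<^sup>+z. ennreal (((1/3) * (r + 1)) ^ q) *
     indicator {z. \<bar>(cmod z)\<^sup>2 - r\<bar> < 1 / (r + 1) powr a} z \<partial>(lborel :: complex measure))"
    by (rule nn_integral_cmult_indicator[symmetric]) measurable
  also have "\<dots> \<le> slice_integral a q r"
    unfolding slice_integral_def
  proof (intro nn_integral_mono)
    fix z :: complex
    show "ennreal (((1/3) * (r + 1)) ^ q) * indicator {z. \<bar>(cmod z)\<^sup>2 - r\<bar> < 1 / (r + 1) powr a} z
      \<le> ennreal (((cmod z)\<^sup>2) ^ q) * indicator {z. \<bar>(cmod z)\<^sup>2 - r\<bar> < 1 / (r + 1) powr a} z"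
    proof (cases "\<bar>(cmod z)\<^sup>2 - r\<bar> < 1 / (r + 1) powr a")
      case True
      then have "\<bar>(cmod z)\<^sup>2 - r\<bar> < 1" using w by (rule order.strict_trans2)
      then have "(1/3) * (r + 1) \<le> (cmod z)\<^sup>2" using r by (simp add: abs_less_iff)
      then show ?thesis using True r by (auto intro!: ennreal_leI power_mono)
    qed simp
  qed
  finally show ?thesis .
qed

text \<open>Collects the exponent of R = |w|^2 + 1: each of the n - 1 slices contributes -a from its
  area, and all coordinates together contribute |p|. Applied with c = 1 for the upper and c = 1/3
  for the lower estimate.\<close>

lemma monomial_weight_eq:
  fixes p :: "'n::finite \<Rightarrow> nat"
  assumes R: "0 < R"
  shows "(c * R) ^ p m * (\<Prod>k\<in>UNIV-{m}. (c * R) ^ p k * (2 * pi * R powr (-a)))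
     = c ^ mi_length p * (2 * pi) ^ (CARD('n) - 1) *
       R powr (real (mi_length p) - (real CARD('n) - 1) * a)"
proof -
  have ins: "insert m (UNIV - {m}) = (UNIV :: 'n set)" by auto
  have len: "mi_length p = p m + (\<Sum>k\<in>UNIV-{m}. p k)"
    unfolding mi_length_def by (subst ins[symmetric], subst sum.insert) auto
  have "(\<Prod>k\<in>UNIV-{m}. (c * R) ^ p k * (2 * pi * R powr (-a)))
    = (c * R) ^ (\<Sum>k\<in>UNIV-{m}. p k) * ((2 * pi) ^ (CARD('n) - 1) * (R powr (-a)) ^ (CARD('n) - 1))"
    by (simp add: prod.distrib power_sum card_Diff_singleton power_mult_distrib)
  then have "(c * R) ^ p m * (\<Prod>k\<in>UNIV-{m}. (c * R) ^ p k * (2 * pi * R powr (-a)))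
    = (c * R) ^ mi_length p * ((2 * pi) ^ (CARD('n) - 1) * (R powr (-a)) ^ (CARD('n) - 1))"
    by (simp add: len power_add)
  also have "(R powr (-a)) ^ (CARD('n) - 1) = R powr (- (real CARD('n) - 1) * a)"
    using R by (simp add: powr_power of_nat_diff Suc_leI algebra_simps)
  also have "(c * R) ^ mi_length p = c ^ mi_length p * R powr (real (mi_length p))"
    using R by (simp add: power_mult_distrib powr_realpow)
  finally have 1: "(c * R) ^ p m * (\<Prod>k\<in>UNIV-{m}. (c * R) ^ p k * (2 * pi * R powr (-a)))
    = c ^ mi_length p * R powr real (mi_length p) *
       ((2 * pi) ^ (CARD('n) - 1) * R powr (- (real CARD('n) - 1) * a))" .
  have "R powr (real (mi_length p) - (real CARD('n) - 1) * a)
    = R powr real (mi_length p) * R powr (- (real CARD('n) - 1) * a)"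
    by (simp add: powr_add[symmetric] algebra_simps)
  then show ?thesis
    unfolding 1 by (simp only: mult_ac)
qed

lemma sq_integral_monomial_n_finite:
  fixes p :: "'n::finite \<Rightarrow> nat"
  assumes a: "0 < a" and p: "real (mi_length p) < (real CARD('n) - 1) * a - 1"
  shows "sq_integral (domD a m) (monomial_n p) < \<infinity>"
proof -
  define e where "e = real (mi_length p) - (real CARD('n) - 1) * a"
  define C where "C = (2 * pi) ^ (CARD('n) - 1)"
  have "sq_integral (domD a m) (monomial_n p) \<le> (\<integral>\<^sup>+w. ennreal C * ennreal (((cmod w)\<^sup>2 + 1) powr e) \<partial>lborel)"
    unfolding sq_integral_monomial_n
  proof (intro nn_integral_mono)
    fix w :: complex
    define R where "R = (cmod w)\<^sup>2 + 1"
    have R: "0 < R" "1 \<le> R" by (auto simp: R_def add_nonneg_pos)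
    have "ennreal (((cmod w)\<^sup>2) ^ p m) * (\<Prod>k\<in>UNIV-{m}. slice_integral a (p k) ((cmod w)\<^sup>2))
      \<le> ennreal (R ^ p m) * (\<Prod>k\<in>UNIV-{m}. ennreal (R ^ p k * (2 * pi * R powr (-a))))"
      unfolding R_def
      by (intro mult_mono ennreal_leI power_mono prod_mono_ennreal slice_integral_upper a) auto
    also have "\<dots> = ennreal (R ^ p m * (\<Prod>k\<in>UNIV-{m}. R ^ p k * (2 * pi * R powr (-a))))"
      using R by (subst prod_ennreal) (auto simp: ennreal_mult' prod_nonneg)
    also have "\<dots> = ennreal (C * R powr e)"
      using monomial_weight_eq[of R 1 p m a] R by (simp add: C_def e_def)
    also have "\<dots> = ennreal C * ennreal (R powr e)"
      by (simp add: ennreal_mult' C_def)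
    finally show "ennreal (((cmod w)\<^sup>2) ^ p m) * (\<Prod>k\<in>UNIV-{m}. slice_integral a (p k) ((cmod w)\<^sup>2))
      \<le> ennreal C * ennreal (((cmod w)\<^sup>2 + 1) powr e)"
      by (simp add: R_def)
  qed
  also have "\<dots> = ennreal C * (\<integral>\<^sup>+w. ennreal (((cmod w)\<^sup>2 + 1) powr e) \<partial>(lborel :: complex measure))"
    by (rule nn_integral_cmult) measurable
  also have "\<dots> < \<infinity>"
    using nn_integral_radial_finite[of e] p by (simp add: e_def ennreal_mult_less_top)
  finally show ?thesis .
qed

lemma sq_integral_monomial_n_infinite:
  fixes p :: "'n::finite \<Rightarrow> nat"
  assumes a: "0 < a" and p: "real (mi_length p) \<ge> (real CARD('n) - 1) * a - 1"
  shows "sq_integral (domD a m) (monomial_n p) = \<infinity>"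
proof -
  define e where "e = real (mi_length p) - (real CARD('n) - 1) * a"
  define C where "C = (1/3) ^ mi_length p * (2 * pi) ^ (CARD('n) - 1)"
  have "\<infinity> = (\<integral>\<^sup>+w. ennreal (C * ((cmod w)\<^sup>2 + 1) powr e) * indicator {z. 2 \<le> (cmod z)\<^sup>2} w \<partial>(lborel :: complex measure))"
    using p by (intro nn_integral_radial_infinite[symmetric]) (auto simp: e_def C_def)
  also have "\<dots> \<le> sq_integral (domD a m) (monomial_n p)"
    unfolding sq_integral_monomial_n
  proof (intro nn_integral_mono)
    fix w :: complex
    define R where "R = (cmod w)\<^sup>2 + 1"
    have R: "0 < R" by (auto simp: R_def add_nonneg_pos)
    show "ennreal (C * ((cmod w)\<^sup>2 + 1) powr e) * indicator {z. 2 \<le> (cmod z)\<^sup>2} w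
      \<le> ennreal (((cmod w)\<^sup>2) ^ p m) * (\<Prod>k\<in>UNIV-{m}. slice_integral a (p k) ((cmod w)\<^sup>2))"
    proof (cases "2 \<le> (cmod w)\<^sup>2")
      case True
      have "ennreal (C * R powr e) = ennreal ((1/3 * R) ^ p m * (\<Prod>k\<in>UNIV-{m}. (1/3 * R) ^ p k * (2 * pi * R powr (-a))))"
        using monomial_weight_eq[of R "1/3" p m a] R by (simp add: C_def e_def)
      also have "\<dots> = ennreal ((1/3 * R) ^ p m) * (\<Prod>k\<in>UNIV-{m}. ennreal ((1/3 * R) ^ p k * (2 * pi * R powr (-a))))"
        using R by (subst prod_ennreal) (auto simp: ennreal_mult' prod_nonneg)
      also have "\<dots> \<le> ennreal (((cmod w)\<^sup>2) ^ p m) * (\<Prod>k\<in>UNIV-{m}. slice_integral a (p k) ((cmod w)\<^sup>2))"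
        unfolding R_def using True
        by (intro mult_mono ennreal_leI power_mono prod_mono_ennreal slice_integral_lower a) auto
      finally show ?thesis using True by (simp add: R_def)
    qed simp
  qed
  finally show ?thesis by (simp add: top.extremum_unique)
qed


section \<open>Averages over roots of unity\<close>

text \<open>The s-th power of the standard primitive N-th root of unity. For N = 0 the quotient is 0
  and the value is 1.\<close>

definition chi :: "nat \<Rightarrow> nat \<Rightarrow> complex" where
  "chi N s = exp (2 * of_real pi * \<i> * of_nat s / of_nat N)"

lemma norm_chi [simp]: "cmod (chi N s) = 1"
proof -
  have "chi N s = cis (2 * pi * real s / real N)"
    by (simp add: chi_def cis_conv_exp mult_ac)
  then show ?thesis by simp
qed

lemma chi_nonzero [simp]: "chi N s \<noteq> 0"
  by (simp add: chi_def)

lemma chi_0 [simp]: "chi N 0 = 1"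
  by (simp add: chi_def)

lemma chi_power: "chi N s ^ k = chi N (s * k)"
  by (simp add: chi_def exp_of_nat_mult[symmetric] mult_ac)

text \<open>The Fourier matrix of order N is symmetric. This turns sums over the weight k into sums
  over the rotations s, to which \<open>sum_chi\<close> applies.\<close>

lemma chi_power_swap: "chi N s ^ k = chi N k ^ s"
  by (simp add: chi_power mult.commute)

lemma chi_eq_iff: "0 < N \<Longrightarrow> chi N j = chi N k \<longleftrightarrow> j mod N = k mod N"
  unfolding chi_def by (rule complex_root_unity_eq) simp

text \<open>Orthogonality of the characters of Z/N, by a geometric sum. The quotient form avoids the
  truncated difference j - k. Exponents count only mod N; this is the aliasing that later uses must
  exclude or estimate.\<close>

lemma sum_chi:
  assumes N: "0 < N"
  shows "(\<Sum>s<N. chi N s ^ j / chi N s ^ k) = (if j mod N = k mod N then of_nat N else 0)"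
proof -
  define v where "v = chi N j / chi N k"
  have "(\<Sum>s<N. chi N s ^ j / chi N s ^ k) = (\<Sum>s<N. v ^ s)"
    by (intro sum.cong) (simp_all add: v_def chi_power power_divide mult.commute)
  moreover have "v ^ N = 1"
    using N chi_eq_iff[of N "N * j" 0] chi_eq_iff[of N "N * k" 0]
    by (simp add: v_def chi_power power_divide mult.commute)
  moreover have "v = 1 \<longleftrightarrow> j mod N = k mod N"
    using N by (simp add: v_def chi_eq_iff)
  ultimately show ?thesis
    by (auto simp: sum_gp_strict)
qed

text \<open>Discretised projection onto the functions of weight k under simultaneous rotation of the
  coordinates in I.\<close>

definition ravg :: "nat \<Rightarrow> 'n set \<Rightarrow> nat \<Rightarrow> (complex ^ 'n \<Rightarrow> complex) \<Rightarrow> complex ^ 'n \<Rightarrow> complex" where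
  "ravg N I k g z = (\<Sum>s<N. g (rot (\<lambda>j. if j \<in> I then chi N s else 1) z) / chi N s ^ k) / of_nat N"

text \<open>Measurability is asked of the product with the indicator, because limits of averages are
  controlled on \<open>D\<close> only.\<close>

definition sq_integrable :: "(complex ^ 'n::finite) set \<Rightarrow> (complex ^ 'n \<Rightarrow> complex) \<Rightarrow> bool" where
  "sq_integrable D g \<longleftrightarrow>
     (\<lambda>z. indicator D z * g z) \<in> borel_measurable borel \<and> sq_integral D g < \<infinity>"

definition rot_invariant :: "(complex ^ 'n::finite) set \<Rightarrow> bool" where
  "rot_invariant D \<longleftrightarrow> (\<forall>u z. (\<forall>i. cmod (u i) = 1) \<longrightarrow> (rot u z \<in> D \<longleftrightarrow> z \<in> D))"

lemma rot_invariant_domD: "rot_invariant (domD a m)"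
  by (simp add: rot_invariant_def domD_def norm_mult)

lemma sq_integral_rot:
  assumes D: "rot_invariant D" and g: "(\<lambda>z. indicator D z * g z) \<in> borel_measurable borel"
    and u: "\<And>i. cmod (u i) = 1"
  shows "sq_integral D (\<lambda>z. g (rot u z)) = sq_integral D g"
proof -
  have eq: "ennreal ((cmod (g z))\<^sup>2) * indicator D z = ennreal ((cmod (indicator D z * g z))\<^sup>2)" for z
    by (simp add: indicator_def)
  have [measurable]: "(\<lambda>z. ennreal ((cmod (g z))\<^sup>2) * indicator D z) \<in> borel_measurable borel"
    unfolding eq using g by measurable
  have ind: "indicator D z = (indicator D (rot u z) :: ennreal)" for z
    using D u by (simp add: rot_invariant_def indicator_def)
  have "sq_integral D (\<lambda>z. g (rot u z)) =
     (\<integral>\<^sup>+z. ennreal ((cmod (g (rot u z)))\<^sup>2) * indicator D (rot u z) \<partial>lborel)"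
    unfolding sq_integral_def ind[symmetric] ..
  also have "\<dots> = (\<integral>\<^sup>+z. ennreal ((cmod (g z))\<^sup>2) * indicator D z \<partial>distr lborel borel (rot u))"
    by (subst nn_integral_distr) auto
  also have "\<dots> = sq_integral D g"
    unfolding sq_integral_def distr_lborel_rot[OF u] ..
  finally show ?thesis .
qed

lemma ravg_measurable:
  assumes D: "rot_invariant D" and g: "(\<lambda>z. indicator D z * g z) \<in> borel_measurable borel"
  shows "(\<lambda>z. indicator D z * ravg N I k g z) \<in> borel_measurable borel"
proof -
  define r where "r = (\<lambda>s. rot (\<lambda>j. if j \<in> I then chi N s else 1) :: complex ^ 'a \<Rightarrow> _)"
  have [measurable]: "r s \<in> borel_measurable borel" for s unfolding r_def by measurable
  note g [measurable]
  have "indicator D z * ravg N I k g z = (\<Sum>s<N. (indicator D (r s z) * g (r s z)) / chi N s ^ k) / of_nat N" for z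
  proof -
    have "(indicator D (r s z) :: complex) = indicator D z" for s
      using D by (simp add: rot_invariant_def indicator_def r_def)
    then show ?thesis
      by (simp add: ravg_def r_def sum_distrib_left)
  qed
  moreover have "(\<lambda>z. indicator D (r s z) * g (r s z)) \<in> borel_measurable borel" for s
    using measurable_compose[of "r s" borel borel, OF _ g] by simp
  ultimately show ?thesis
    by (simp) measurable
qed

lemma norm_sum_sq_le:
  fixes h :: "nat \<Rightarrow> complex"
  shows "(cmod (\<Sum>s<N. h s))\<^sup>2 \<le> real N * (\<Sum>s<N. (cmod (h s))\<^sup>2)"
proof -
  have "(cmod (\<Sum>s<N. h s))\<^sup>2 \<le> (\<Sum>s<N. 1 * cmod (h s))\<^sup>2"
    by (intro power_mono) (auto intro: norm_sum)
  also have "\<dots> \<le> (\<Sum>s<N. 1\<^sup>2) * (\<Sum>s<N. (cmod (h s))\<^sup>2)"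
    by (rule Cauchy_Schwarz_ineq_sum)
  finally show ?thesis by simp
qed

text \<open>An average is a mean of N rotated copies of \<open>g\<close>, up to unit factors, and
  each copy has the norm of \<open>g\<close>. By Cauchy-Schwarz the square of a mean is at most the
  mean of the squares. The bound is uniform in N, as Fatou's lemma will require.\<close>

lemma sq_integral_ravg_le:
  assumes D: "rot_invariant D" "D \<in> sets borel" and g: "(\<lambda>z. indicator D z * g z) \<in> borel_measurable borel"
  shows "sq_integral D (ravg N I k g) \<le> sq_integral D g"
proof (cases "N = 0")
  case True
  \<comment> \<open>For N = 0 the average is 0 divided by 0, hence the zero function.\<close>
  then show ?thesis by (simp add: ravg_def sq_integral_def)
next
  case False
  define r where "r = (\<lambda>s. rot (\<lambda>j. if j \<in> I then chi N s else 1) :: complex ^ 'a \<Rightarrow> _)"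
  have [measurable]: "r s \<in> borel_measurable borel" for s unfolding r_def by measurable
  have [measurable]: "(\<lambda>z. ennreal ((cmod (g (r s z)))\<^sup>2) * indicator D z) \<in> borel_measurable borel" for s
  proof -
    have "ennreal ((cmod (g (r s z)))\<^sup>2) * indicator D z = ennreal ((cmod (indicator D (r s z) * g (r s z)))\<^sup>2)" for z
      using D by (simp add: rot_invariant_def indicator_def r_def)
    moreover have "(\<lambda>z. indicator D (r s z) * g (r s z)) \<in> borel_measurable borel"
      using measurable_compose[of "r s" borel borel, OF _ g] by simp
    ultimately show ?thesis by simp
  qed
  have pt: "ennreal ((cmod (ravg N I k g z))\<^sup>2) * indicator D z
     \<le> ennreal (1 / real N) * (\<Sum>s<N. ennreal ((cmod (g (r s z)))\<^sup>2) * indicator D z)" for z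
  proof -
    have "(cmod (ravg N I k g z))\<^sup>2 = (cmod (\<Sum>s<N. g (r s z) / chi N s ^ k))\<^sup>2 / (real N)\<^sup>2"
      by (simp add: ravg_def r_def norm_divide power_divide)
    also have "\<dots> \<le> (real N * (\<Sum>s<N. (cmod (g (r s z) / chi N s ^ k))\<^sup>2)) / (real N)\<^sup>2"
      by (intro divide_right_mono norm_sum_sq_le) simp
    also have "\<dots> = 1 / real N * (\<Sum>s<N. (cmod (g (r s z)))\<^sup>2)"
      using False by (simp add: norm_divide norm_power power2_eq_square)
    finally have "ennreal ((cmod (ravg N I k g z))\<^sup>2) \<le> ennreal (1 / real N * (\<Sum>s<N. (cmod (g (r s z)))\<^sup>2))"
      by (rule ennreal_leI)
    also have "\<dots> = ennreal (1 / real N) * (\<Sum>s<N. ennreal ((cmod (g (r s z)))\<^sup>2))"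
      by (subst ennreal_mult') (simp_all add: sum_nonneg)
    finally show ?thesis
      by (simp add: indicator_def)
  qed
  have "sq_integral D (ravg N I k g) \<le> (\<integral>\<^sup>+z. ennreal (1 / real N) * (\<Sum>s<N. ennreal ((cmod (g (r s z)))\<^sup>2) * indicator D z) \<partial>lborel)"
    unfolding sq_integral_def by (intro nn_integral_mono pt)
  also have "\<dots> = ennreal (1 / real N) * (\<integral>\<^sup>+z. (\<Sum>s<N. ennreal ((cmod (g (r s z)))\<^sup>2) * indicator D z) \<partial>lborel)"
    by (rule nn_integral_cmult) measurable
  also have "(\<integral>\<^sup>+z. (\<Sum>s<N. ennreal ((cmod (g (r s z)))\<^sup>2) * indicator D z) \<partial>lborel)
      = (\<Sum>s<N. sq_integral D (\<lambda>z. g (r s z)))"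
    unfolding sq_integral_def by (rule nn_integral_sum) measurable
  also have "(\<Sum>s<N. sq_integral D (\<lambda>z. g (r s z))) = ennreal (real N) * sq_integral D g"
    unfolding r_def by (simp add: sq_integral_rot[OF D(1) g] ennreal_of_nat_eq_real_of_nat)
  also have "ennreal (1 / real N) * (ennreal (real N) * sq_integral D g) = ennreal (1 / real N * real N) * sq_integral D g"
    by (subst ennreal_mult') (simp_all add: mult.assoc)
  also have "\<dots> = sq_integral D g" using False by simp
  finally show ?thesis .
qed

lemma sq_integrable_ravg:
  assumes "rot_invariant D" "D \<in> sets borel" "sq_integrable D g"
  shows "sq_integrable D (ravg N I k g)"
  using assms sq_integral_ravg_le[of D g N I k] ravg_measurable[of D g N I k]
  by (auto simp: sq_integrable_def)


section \<open>Homogeneous expansion on a balanced domain\<close>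

lemma norm_vector_scalar_mult: "norm (c *s z) = cmod c * norm (z :: complex ^ 'n::finite)"
  by (simp add: norm_vec_def norm_mult L2_set_right_distrib)

lemma bounded_linear_vector_scalar_mult_left:
  "bounded_linear (\<lambda>l::complex. l *s (v :: complex ^ 'n::finite))"
  by (rule bounded_linear_intro[where K="norm v"])
     (auto simp: norm_vector_scalar_mult vec_eq_iff algebra_simps)

lemmas has_derivative_vector_scalar_mult_left =
  bounded_linear.has_derivative[OF bounded_linear_vector_scalar_mult_left]

lemma continuous_on_affine_line:
  "continuous_on A (\<lambda>l::complex. u + l *s (v :: complex ^ 'n::finite))"
  by (intro continuous_intros linear_continuous_on bounded_linear_vector_scalar_mult_left)

lemma holomorphic_n_imp_continuous_on: "holomorphic_n f D \<Longrightarrow> continuous_on D f"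
  unfolding holomorphic_n_def
  by (auto intro!: continuous_at_imp_continuous_on dest: has_derivative_continuous)

text \<open>Complex linearity of the derivative L enters here: along the line the derivative is h
  |-> L (h v) = h L v, which is multiplication by a complex number.\<close>

lemma holomorphic_on_line:
  fixes D :: "(complex ^ 'n::finite) set"
  assumes "holomorphic_n f D"
  shows "(\<lambda>l. f (u + l *s v)) holomorphic_on {l. u + l *s v \<in> D}"
proof (rule holomorphic_onI)
  fix l assume "l \<in> {l. u + l *s v \<in> D}"
  then obtain L where L: "(f has_derivative L) (at (u + l *s v))" "\<And>c w. L (c *s w) = c * L w"
    using assms unfolding holomorphic_n_def by blast
  have "((\<lambda>l. u + l *s v) has_derivative (\<lambda>h. h *s v)) (at l)"
    using has_derivative_vector_scalar_mult_left[OF has_derivative_ident]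
    by (auto intro!: derivative_eq_intros)
  from has_derivative_compose[OF this L(1)]
  have "((\<lambda>l. f (u + l *s v)) has_derivative (\<lambda>h. L v * h)) (at l)"
    by (simp add: L(2) mult.commute)
  then show "(\<lambda>l. f (u + l *s v)) field_differentiable at l within {l. u + l *s v \<in> D}"
    unfolding field_differentiable_def has_field_derivative_def
    using has_derivative_at_withinI by blast
qed

text \<open>Defined for every z, not only z in the domain, since f (l z) is holomorphic in l near 0.\<close>

definition hcoef :: "(complex ^ 'n \<Rightarrow> complex) \<Rightarrow> nat \<Rightarrow> complex ^ 'n \<Rightarrow> complex" where
  "hcoef f d z = (deriv ^^ d) (\<lambda>l. f (l *s z)) 0 / fact d"

text \<open>Isolates what the homogeneous expansion uses of the domain; openness is part of
  \<open>holo\<close>. Invariance under separate rotations is added as an assumption where norms are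
  compared.\<close>

locale balanced_holomorphic =
  fixes D :: "(complex ^ 'n::finite) set" and f :: "complex ^ 'n \<Rightarrow> complex"
  assumes zero_mem: "0 \<in> D"
    and balanced: "\<And>z l. z \<in> D \<Longrightarrow> cmod l \<le> 1 \<Longrightarrow> l *s z \<in> D"
    and holo: "holomorphic_n f D"
begin

lemma open_D: "open D"
  using holo by (simp add: holomorphic_n_def)

lemma open_line: "open {l. u + l *s v \<in> D}"
  using open_vimage[OF open_D continuous_on_affine_line[of UNIV u v]]
  by (simp add: vimage_def)

lemma holomorphic_slice: "(\<lambda>l. f (l *s z)) holomorphic_on {l. l *s z \<in> D}"
  and open_slice: "open {l. l *s z \<in> D}"
  using holomorphic_on_line[OF holo, of 0 z] open_line[of 0 z] by auto

text \<open>Openness gives a point 1 + e of the slice, and balancedness fills the disc it spans. A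
  radius above 1 puts the point l = 1, where f(z) itself is read off, strictly inside the disc of
  convergence.\<close>

lemma slice_ball:
  assumes z: "z \<in> D"
  obtains \<rho> where "1 < \<rho>" "ball 0 \<rho> \<subseteq> {l. l *s z \<in> D}"
proof -
  obtain e where e: "0 < e" "cball 1 e \<subseteq> {l. l *s z \<in> D}"
    using open_slice[of z] z open_contains_cball[of "{l. l *s z \<in> D}"]
    by (metis mem_Collect_eq vector_smult_lid)
  show ?thesis
  proof (rule that[of "1 + e"])
    show "ball 0 (1 + e) \<subseteq> {l. l *s z \<in> D}"
    proof safe
      fix l :: complex assume l: "l \<in> ball 0 (1 + e)"
      have "of_real (1 + e) \<in> cball (1::complex) e"
        using e(1) by (simp add: dist_norm)
      then have "of_real (1 + e) *s z \<in> D" using e(2) by blast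
      moreover have "cmod (l / of_real (1 + e)) \<le> 1"
        using l e(1) unfolding norm_divide norm_of_real by simp
      ultimately have "(l / of_real (1 + e)) *s (of_real (1 + e) *s z) \<in> D"
        by (rule balanced)
      moreover have "(of_real (1 + e) :: complex) \<noteq> 0"
        using e(1) unfolding of_real_eq_0_iff by simp
      ultimately show "l *s z \<in> D"
        by (simp add: vector_smult_assoc del: of_real_add)
    qed
  qed (use e in simp)
qed

lemma hcoef_sums:
  assumes z: "z \<in> D" and u: "cmod u \<le> 1"
  shows "(\<lambda>d. hcoef f d z * u ^ d) sums f (u *s z)"
proof -
  obtain \<rho> where \<rho>: "1 < \<rho>" "ball 0 \<rho> \<subseteq> {l. l *s z \<in> D}" using slice_ball[OF z] .
  have "(\<lambda>l. f (l *s z)) holomorphic_on ball 0 \<rho>"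
    using holomorphic_slice \<rho>(2) by (rule holomorphic_on_subset)
  from holomorphic_power_series[OF this, of u] show ?thesis
    using u \<rho> by (simp add: hcoef_def)
qed

lemma summable_norm_hcoef:
  assumes z: "z \<in> D"
  shows "summable (\<lambda>d. norm (hcoef f d z))"
proof -
  obtain \<rho> where \<rho>: "1 < \<rho>" "ball 0 \<rho> \<subseteq> {l. l *s z \<in> D}" using slice_ball[OF z] .
  \<comment> \<open>A point with 1 < |x| < \<rho>: convergence of the power series at
    \<open>x\<close> forces absolute convergence at 1.\<close>
  define x :: complex where "x = of_real ((1 + \<rho>) / 2)"
  have x: "cmod x = (1 + \<rho>) / 2" using \<rho>(1) unfolding x_def norm_of_real by simp
  have "(\<lambda>l. f (l *s z)) holomorphic_on ball 0 \<rho>"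
    using holomorphic_slice \<rho>(2) by (rule holomorphic_on_subset)
  from holomorphic_power_series[OF this, of x]
  have "summable (\<lambda>d. hcoef f d z * x ^ d)"
    using x \<rho> by (simp add: hcoef_def sums_iff)
  from powser_insidea[OF this, of 1] show ?thesis
    using x \<rho>(1) by simp
qed

text \<open>Both sides are derivatives at 0, where the two slices differ by the substitution l |-> c
  l. Hence \<open>c\<close> and \<open>z\<close> are arbitrary, even if \<open>c *s z\<close> leaves
  \<open>D\<close>, and bounds near 0 can be carried to the whole space.\<close>

lemma hcoef_scale: "hcoef f d (c *s z) = c ^ d * hcoef f d z"
proof -
  have "(deriv ^^ d) (\<lambda>l. f ((c * l) *s z)) 0 = c ^ d * (deriv ^^ d) (\<lambda>l. f (l *s z)) (c * 0)"
  proof (rule higher_deriv_compose_linear)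
    show "open {l. l *s (c *s z) \<in> D}" by (rule open_slice)
    show "c * w \<in> {l. l *s z \<in> D}" if "w \<in> {l. l *s (c *s z) \<in> D}" for w
      using that by (simp add: vector_smult_assoc mult.commute)
  qed (use zero_mem open_slice holomorphic_slice in auto)
  then show ?thesis
    by (simp add: hcoef_def vector_smult_assoc mult.commute)
qed

lemma ravg_UNIV: "ravg N UNIV d g z = (\<Sum>s<N. g (chi N s *s z) / chi N s ^ d) / of_nat N"
proof -
  have "rot (\<lambda>j. if j \<in> UNIV then c else 1) z = c *s z" for c by (simp add: vec_eq_iff)
  then show ?thesis by (simp add: ravg_def)
qed

text \<open>Averaging the series term by term keeps exactly the degrees j congruent to d mod N.
  Since d < N, every such j other than d is at least N, so the error is bounded by the tail from N
  on.\<close>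

lemma norm_ravg_minus_hcoef_le:
  assumes z: "z \<in> D" and d: "d < N"
  shows "norm (ravg N UNIV d f z - hcoef f d z) \<le> (\<Sum>j. norm (hcoef f (j + N) z))"
proof -
  define t where "t = (\<lambda>j. if j mod N = d mod N then hcoef f j z else 0)"
  have "(\<lambda>j. (\<Sum>s<N. hcoef f j z * chi N s ^ j / chi N s ^ d) / of_nat N) sums ravg N UNIV d f z"
    unfolding ravg_UNIV by (intro sums_divide sums_sum hcoef_sums z) simp
  also have "(\<lambda>j. (\<Sum>s<N. hcoef f j z * chi N s ^ j / chi N s ^ d) / of_nat N) = t"
  proof
    fix j
    have "(\<Sum>s<N. hcoef f j z * chi N s ^ j / chi N s ^ d) = hcoef f j z * (\<Sum>s<N. chi N s ^ j / chi N s ^ d)"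
      by (simp add: sum_distrib_left)
    then show "(\<Sum>s<N. hcoef f j z * chi N s ^ j / chi N s ^ d) / of_nat N = t j"
      using d by (simp add: sum_chi t_def)
  qed
  finally have t: "t sums ravg N UNIV d f z" .
  have "(\<lambda>j. if j = d then hcoef f d z else 0) sums hcoef f d z"
    by (rule sums_single)
  from sums_diff[OF t this]
  have diff: "(\<lambda>j. t j - (if j = d then hcoef f d z else 0)) sums (ravg N UNIV d f z - hcoef f d z)" .
  define b where "b = (\<lambda>j. if j < N then 0 else norm (hcoef f j z))"
  have sum_b: "summable b"
    by (rule summable_comparison_test'[OF summable_norm_hcoef[OF z], of 0]) (simp add: b_def)
  have "norm (ravg N UNIV d f z - hcoef f d z) = norm (\<Sum>j. t j - (if j = d then hcoef f d z else 0))"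
    using diff by (simp add: sums_iff)
  also have "\<dots> \<le> suminf b"
    using d by (intro norm_suminf_le sum_b) (auto simp: t_def b_def)
  also have "\<dots> = (\<Sum>j. b (j + N)) + (\<Sum>j<N. b j)"
    by (rule suminf_split_initial_segment[OF sum_b])
  also have "\<dots> = (\<Sum>j. norm (hcoef f (j + N) z))"
    by (simp add: b_def)
  finally show ?thesis .
qed

lemma ravg_tendsto_hcoef:
  assumes z: "z \<in> D"
  shows "(\<lambda>N. ravg N UNIV d f z) \<longlonglongrightarrow> hcoef f d z"
proof (rule LIMSEQ_I)
  fix r :: real assume "0 < r"
  then obtain N0 where N0: "\<And>n. n \<ge> N0 \<Longrightarrow> norm (\<Sum>j. norm (hcoef f (j + n) z)) < r"
    using suminf_exist_split[OF _ summable_norm_hcoef[OF z]] by blast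
  have "norm (ravg N UNIV d f z - hcoef f d z) < r" if "N \<ge> max N0 (Suc d)" for N
    using norm_ravg_minus_hcoef_le[OF z, of d N] N0[of N] that by simp
  then show "\<exists>N0. \<forall>N\<ge>N0. norm (ravg N UNIV d f z - hcoef f d z) < r" by blast
qed

text \<open>Cauchy's inequality on the disc |l| \<le> 2 of the slice, which stays in the ball of
  radius r because |z| \<le> r/2. Radius 2 yields the factor 2^(-d), a geometric majorant
  independent of \<open>z\<close>.\<close>

lemma hcoef_bound_near_0:
  obtains r M where "0 < r" "cball 0 r \<subseteq> D" "0 \<le> M"
    "\<And>z d. norm z \<le> r / 2 \<Longrightarrow> norm (hcoef f d z) \<le> M / 2 ^ d"
proof -
  obtain r where r: "0 < r" "cball 0 r \<subseteq> D"
    using open_D zero_mem open_contains_cball by blast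
  have "compact (f ` cball 0 r)"
    using holomorphic_n_imp_continuous_on[OF holo] r(2)
    by (intro compact_continuous_image) (auto intro: continuous_on_subset)
  then obtain M where M: "\<And>z. z \<in> cball 0 r \<Longrightarrow> norm (f z) \<le> M"
    by (meson bounded_iff compact_imp_bounded imageI)
  have "norm (hcoef f d z) \<le> M / 2 ^ d" if z: "norm z \<le> r / 2" for z d
  proof -
    have in_ball: "l *s z \<in> cball 0 r" if "cmod l \<le> 2" for l
    proof -
      have "cmod l * norm z \<le> 2 * (r / 2)" using that z by (intro mult_mono) auto
      then show ?thesis by (simp add: norm_vector_scalar_mult)
    qed
    have sub: "cball 0 2 \<subseteq> {l. l *s z \<in> D}" using in_ball r(2) by auto
    have hol: "(\<lambda>l. f (l *s z)) holomorphic_on cball 0 2"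
      using holomorphic_slice sub by (rule holomorphic_on_subset)
    have "norm ((deriv ^^ d) (\<lambda>l. f (l *s z)) 0) \<le> fact d * M / 2 ^ d"
    proof (rule Cauchy_inequality)
      show "(\<lambda>l. f (l *s z)) holomorphic_on ball 0 2"
        using hol by (rule holomorphic_on_subset) auto
      show "continuous_on (cball 0 2) (\<lambda>l. f (l *s z))"
        using hol by (rule holomorphic_on_imp_continuous_on)
      show "norm (f (x *s z)) \<le> M" if "norm (0 - x) = 2" for x
        using that by (intro M in_ball) simp
    qed simp
    then show ?thesis
      by (simp add: hcoef_def norm_divide field_simps)
  qed
  moreover have "0 \<le> M" using order_trans[OF norm_ge_zero M[of 0]] r(1) by simp
  ultimately show ?thesis using that r by blast
qed

lemma hcoef_growth:
  obtains C where "\<And>z. norm (hcoef f d z) \<le> C * norm z ^ d"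
proof -
  obtain r M where r: "0 < r" "0 \<le> M" and
    bd: "\<And>z d. norm z \<le> r / 2 \<Longrightarrow> norm (hcoef f d z) \<le> M / 2 ^ d"
    using hcoef_bound_near_0 by metis
  have "norm (hcoef f d z) \<le> M / r ^ d * norm z ^ d" for z
  proof (cases "z = 0")
    case True
    \<comment> \<open>At z = 0 the bound contains \<open>0 ^ d\<close>, which is 1 for d = 0. That
      case uses the estimate at 0; for d > 0 homogeneity makes the coefficient vanish.\<close>
    show ?thesis
    proof (cases "d = 0")
      case True
      with bd[of z 0] \<open>z = 0\<close> r show ?thesis by simp
    next
      case False
      with hcoef_scale[of d 0 z] \<open>z = 0\<close> show ?thesis by (simp add: zero_power)
    qed
  next
    case False
    \<comment> \<open>Scaling by \<open>t\<close> moves z to the sphere of radius r/2. Undoing it by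
      homogeneity cancels 2^d and leaves the constant M / r^d.\<close>
    define t :: complex where "t = of_real (r / (2 * norm z))"
    have t: "cmod t = r / (2 * norm z)" using r(1) unfolding t_def norm_of_real by simp
    have "norm (hcoef f d (t *s z)) \<le> M / 2 ^ d"
      using False by (intro bd) (simp add: norm_vector_scalar_mult t)
    then have "(r / (2 * norm z)) ^ d * norm (hcoef f d z) \<le> M / 2 ^ d"
      by (simp add: hcoef_scale norm_mult norm_power t)
    then show ?thesis
      using False r(1) by (simp add: field_simps power_mult_distrib power_divide)
  qed
  then show ?thesis using that by blast
qed

text \<open>Homogeneity shrinks a disc of the line into the small ball about 0 in which the
  geometric majorant holds. There the averages are holomorphic in l and converge uniformly; dividing
  the limit by \<open>t ^ d\<close> returns to the original disc.\<close>

lemma hcoef_holomorphic_line: "(\<lambda>l. hcoef f d (u + l *s v)) holomorphic_on UNIV"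
proof -
  obtain r M where r: "0 < r" "cball 0 r \<subseteq> D" "0 \<le> M" and
    bd: "\<And>z d. norm z \<le> r / 2 \<Longrightarrow> norm (hcoef f d z) \<le> M / 2 ^ d"
    using hcoef_bound_near_0 by metis
  have "(\<lambda>l. hcoef f d (u + l *s v)) field_differentiable at l0" for l0
  proof -
    \<comment> \<open>Bounds |u + l v| on the disc |l - l0| \<le> 1; the final 1 keeps it positive
      when u = v = 0. Scaling by r / (2 R) thus lands in the ball of radius r/2.\<close>
    define R where "R = norm u + (cmod l0 + 1) * norm v + 1"
    have R: "0 < R" unfolding R_def by (intro add_nonneg_pos add_nonneg_nonneg mult_nonneg_nonneg) auto
    define t :: complex where "t = of_real (r / (2 * R))"
    have t: "cmod t = r / (2 * R)" using r(1) R unfolding t_def norm_of_real by simp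
    have t0: "t \<noteq> 0" using t r(1) R by auto
    have small: "norm (t *s u + l *s (t *s v)) \<le> r / 2" if "l \<in> cball l0 1" for l
    proof -
      have "cmod l \<le> cmod l0 + 1"
        using that norm_triangle_ineq2[of l l0] by (simp add: dist_norm norm_minus_commute)
      then have "cmod l * norm v \<le> (cmod l0 + 1) * norm v"
        by (intro mult_right_mono) auto
      then have "norm (u + l *s v) \<le> R"
        using norm_triangle_ineq[of u "l *s v"] by (simp add: R_def norm_vector_scalar_mult)
      then have "cmod t * norm (u + l *s v) \<le> r / (2 * R) * R"
        unfolding t using r(1) R by (intro mult_left_mono) auto
      moreover have eq: "t *s u + l *s (t *s v) = t *s (u + l *s v)"
        by (simp add: vec_eq_iff algebra_simps)
      ultimately show ?thesis unfolding eq norm_vector_scalar_mult using R by simp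
    qed
    have inD: "c *s (t *s u + l *s (t *s v)) \<in> D" if "l \<in> cball l0 1" "cmod c = 1" for l c
      using small[OF that(1)] r(1)
      by (intro subsetD[OF r(2)]) (simp only: mem_cball_0 norm_vector_scalar_mult that(2))
    have hol: "(\<lambda>l. ravg N UNIV d f (t *s u + l *s (t *s v))) holomorphic_on cball l0 1" for N
    proof -
      have "(\<lambda>l. f (chi N s *s (t *s u + l *s (t *s v)))) holomorphic_on cball l0 1" for s
      proof -
        have eq: "chi N s *s (t *s u + l *s (t *s v)) = chi N s *s (t *s u) + l *s (chi N s *s (t *s v))" for l
          by (simp add: vec_eq_iff algebra_simps)
        show ?thesis
          using inD[of _ "chi N s"] unfolding eq
          by (intro holomorphic_on_subset[OF holomorphic_on_line[OF holo]]) auto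
      qed
      then show ?thesis
        unfolding ravg_UNIV by (intro holomorphic_intros) auto
    qed
    have ulim: "uniform_limit (cball l0 1) (\<lambda>N l. ravg N UNIV d f (t *s u + l *s (t *s v)))
       (\<lambda>l. hcoef f d (t *s u + l *s (t *s v))) sequentially"
    proof (rule uniform_limitI)
      fix e :: real assume e: "0 < e"
      have sb: "summable (\<lambda>j. M / 2 ^ j)"
        using summable_mult[OF summable_geometric[of "1/2::real"], of M] by (simp add: power_divide)
      obtain N0 where N0: "\<And>n. n \<ge> N0 \<Longrightarrow> norm (\<Sum>j. M / 2 ^ (j + n)) < e"
        using suminf_exist_split[OF e sb] by blast
      have "dist (ravg N UNIV d f (t *s u + l *s (t *s v))) (hcoef f d (t *s u + l *s (t *s v))) < e"
        if N: "N \<ge> max N0 (Suc d)" and l: "l \<in> cball l0 1" for N l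
      proof -
        let ?z = "t *s u + l *s (t *s v)"
        have zD: "?z \<in> D" using inD[OF l, of 1] by simp
        have "(\<Sum>j. norm (hcoef f (j + N) ?z)) \<le> (\<Sum>j. M / 2 ^ (j + N))"
          by (intro suminf_le bd small[OF l] summable_ignore_initial_segment[OF sb]
              summable_ignore_initial_segment[OF summable_norm_hcoef[OF zD]])
        also have "\<dots> < e" using N0[of N] N by simp
        finally show ?thesis
          using norm_ravg_minus_hcoef_le[OF zD, of d N] N by (simp add: dist_norm)
      qed
      then show "\<forall>\<^sub>F N in sequentially. \<forall>l\<in>cball l0 1.
         dist (ravg N UNIV d f (t *s u + l *s (t *s v))) (hcoef f d (t *s u + l *s (t *s v))) < e"
        unfolding eventually_sequentially by blast
    qed
    have "(\<lambda>l. hcoef f d (t *s u + l *s (t *s v))) holomorphic_on ball l0 1"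
    proof (rule holomorphic_uniform_limit[OF _ ulim])
      show "\<forall>\<^sub>F N in sequentially. continuous_on (cball l0 1) (\<lambda>l. ravg N UNIV d f (t *s u + l *s (t *s v))) \<and>
        (\<lambda>l. ravg N UNIV d f (t *s u + l *s (t *s v))) holomorphic_on ball l0 1"
        using hol holomorphic_on_imp_continuous_on[OF hol] holomorphic_on_subset[OF hol ball_subset_cball]
        by simp
    qed simp_all
    then have "(\<lambda>l. hcoef f d (t *s u + l *s (t *s v)) / t ^ d) holomorphic_on ball l0 1"
      using t0 by (intro holomorphic_intros) auto
    also have "(\<lambda>l. hcoef f d (t *s u + l *s (t *s v)) / t ^ d) = (\<lambda>l. hcoef f d (u + l *s v))"
    proof
      fix l
      have eq: "t *s u + l *s (t *s v) = t *s (u + l *s v)"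
        by (simp add: vec_eq_iff algebra_simps)
      show "hcoef f d (t *s u + l *s (t *s v)) / t ^ d = hcoef f d (u + l *s v)"
        unfolding eq hcoef_scale using t0 by simp
    qed
    finally show ?thesis
      by (auto simp: holomorphic_on_open field_differentiable_def)
  qed
  then show ?thesis
    by (simp add: holomorphic_on_def)
qed

end


section \<open>Separately polynomial functions\<close>

definition vec_upd :: "complex ^ 'n \<Rightarrow> 'n \<Rightarrow> complex \<Rightarrow> complex ^ 'n" where
  "vec_upd z i l = (\<chi> j. if j = i then l else z $ j)"

lemma vec_upd_nth: "vec_upd z i l $ j = (if j = i then l else z $ j)"
  by (simp add: vec_upd_def)

lemma vec_upd_same [simp]: "vec_upd z i (z $ i) = z"
  by (simp add: vec_eq_iff vec_upd_nth)

lemma rot_vec_upd: "rot u (vec_upd z i l) = vec_upd (rot u z) i (u i * l)"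
  by (simp add: vec_eq_iff vec_upd_nth)

lemma rot_vector_scalar_mult: "rot u (c *s z) = c *s rot u z"
  by (simp add: vec_eq_iff mult.left_commute)

text \<open>One degree bound serves all coordinates, while the coefficients may depend arbitrarily
  on the remaining coordinates. Exponents stay below \<open>N\<close>, so that N-th roots of unity
  separate them without aliasing.\<close>

definition seppoly :: "nat \<Rightarrow> (complex ^ 'n \<Rightarrow> complex) \<Rightarrow> bool" where
  "seppoly N g \<longleftrightarrow> (\<forall>z i. \<exists>c. \<forall>l. g (vec_upd z i l) = (\<Sum>j<N. c j * l ^ j))"

definition homog_in :: "'n \<Rightarrow> nat \<Rightarrow> (complex ^ 'n \<Rightarrow> complex) \<Rightarrow> bool" where
  "homog_in i k g \<longleftrightarrow> (\<forall>z l. g (vec_upd z i (l * z $ i)) = l ^ k * g z)"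

definition homog :: "nat \<Rightarrow> (complex ^ 'n \<Rightarrow> complex) \<Rightarrow> bool" where
  "homog d g \<longleftrightarrow> (\<forall>z l. g (l *s z) = l ^ d * g z)"

lemma seppoly_ravg:
  assumes g: "seppoly N g"
  shows "seppoly N (ravg N' I k g)"
  unfolding seppoly_def
proof (intro allI)
  fix z i
  define u where "u = (\<lambda>s j. if j \<in> I then chi N' s else 1)"
  from g have "\<forall>s. \<exists>c. \<forall>l. g (vec_upd (rot (u s) z) i l) = (\<Sum>j<N. c j * l ^ j)"
    unfolding seppoly_def by blast
  then obtain c where c: "\<And>s l. g (vec_upd (rot (u s) z) i l) = (\<Sum>j<N. c s j * l ^ j)"
    by metis
  have "ravg N' I k g (vec_upd z i l)
    = (\<Sum>j<N. ((\<Sum>s<N'. c s j * u s i ^ j / chi N' s ^ k) / of_nat N') * l ^ j)" for l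
  proof -
    have "(\<Sum>s<N'. g (rot (u s) (vec_upd z i l)) / chi N' s ^ k)
      = (\<Sum>s<N'. \<Sum>j<N. c s j * u s i ^ j / chi N' s ^ k * l ^ j)"
      by (simp add: rot_vec_upd c sum_divide_distrib power_mult_distrib mult_ac)
    also have "\<dots> = (\<Sum>j<N. \<Sum>s<N'. c s j * u s i ^ j / chi N' s ^ k * l ^ j)"
      by (rule sum.swap)
    finally have sum: "(\<Sum>s<N'. g (rot (u s) (vec_upd z i l)) / chi N' s ^ k)
      = (\<Sum>j<N. \<Sum>s<N'. c s j * u s i ^ j / chi N' s ^ k * l ^ j)" .
    have "ravg N' I k g (vec_upd z i l) = (\<Sum>s<N'. g (rot (u s) (vec_upd z i l)) / chi N' s ^ k) / of_nat N'"
      by (simp add: ravg_def u_def)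
    then show ?thesis
      unfolding sum by (simp add: sum_divide_distrib sum_distrib_right)
  qed
  then show "\<exists>c. \<forall>l. ravg N' I k g (vec_upd z i l) = (\<Sum>j<N. c j * l ^ j)"
    by (intro exI[of _ "\<lambda>j. (\<Sum>s<N'. c s j * u s i ^ j / chi N' s ^ k) / of_nat N'"] allI)
qed

lemma homog_ravg:
  assumes "homog d g"
  shows "homog d (ravg N I k g)"
  using assms by (simp add: homog_def ravg_def rot_vector_scalar_mult sum_distrib_left)

text \<open>Preserves what earlier averaging achieved when the coordinates are treated one after the
  other: a rotation commutes with scaling a single coordinate.\<close>

lemma homog_in_ravg_other:
  assumes "homog_in i d g"
  shows "homog_in i d (ravg N I k g)"
  unfolding homog_in_def
proof (intro allI)
  fix z l
  have "g (rot u (vec_upd z i (l * z $ i))) = l ^ d * g (rot u z)" for u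
    using assms unfolding homog_in_def
    by (metis mult.left_commute rot_nth rot_vec_upd)
  then show "ravg N I k g (vec_upd z i (l * z $ i)) = l ^ d * ravg N I k g z"
    by (simp add: ravg_def sum_distrib_left)
qed

text \<open>All exponents of z_i are below N, so orthogonality of the characters extracts exactly
  the term of exponent k. No limit in N is involved.\<close>

lemma homog_in_ravg:
  assumes g: "seppoly N g" and k: "k < N"
  shows "homog_in i k (ravg N {i} k g)"
  unfolding homog_in_def
proof (intro allI)
  fix z l
  from g obtain c where c: "\<And>l. g (vec_upd z i l) = (\<Sum>j<N. c j * l ^ j)"
    unfolding seppoly_def by blast
  have *: "ravg N {i} k g (vec_upd z i l) = c k * l ^ k" for l
  proof -
    have rot: "rot (\<lambda>j. if j \<in> {i} then chi N s else 1) (vec_upd z i l) = vec_upd z i (chi N s * l)" for s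
      by (simp add: vec_eq_iff vec_upd_nth)
    have "(\<Sum>s<N. g (rot (\<lambda>j. if j \<in> {i} then chi N s else 1) (vec_upd z i l)) / chi N s ^ k)
      = (\<Sum>s<N. \<Sum>j<N. c j * l ^ j * (chi N s ^ j / chi N s ^ k))"
      unfolding rot c by (simp add: sum_divide_distrib power_mult_distrib mult_ac)
    also have "\<dots> = (\<Sum>j<N. c j * l ^ j * (\<Sum>s<N. chi N s ^ j / chi N s ^ k))"
      by (subst sum.swap) (simp add: sum_distrib_left)
    also have "\<dots> = (\<Sum>j<N. if j = k then c j * l ^ j * of_nat N else 0)"
      using k by (intro sum.cong) (auto simp: sum_chi)
    also have "\<dots> = c k * l ^ k * of_nat N"
      using k by simp
    finally show ?thesis
      using k by (simp add: ravg_def)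
  qed
  show "ravg N {i} k g (vec_upd z i (l * z $ i)) = l ^ k * ravg N {i} k g z"
    using *[of "l * z $ i"] *[of "z $ i"] by (simp add: power_mult_distrib)
qed

text \<open>Inversion of the finite Fourier transform: summing the characters over the weights k
  annihilates every rotation except s = 0, the identity.\<close>

lemma sum_ravg:
  assumes N: "0 < N"
  shows "(\<Sum>k<N. ravg N I k g z) = g z"
proof -
  define u where "u = (\<lambda>s j. if j \<in> I then chi N s else 1)"
  have u0: "rot (u 0) z = z" by (simp add: u_def vec_eq_iff)
  have "(\<Sum>k<N. ravg N I k g z) = (\<Sum>k<N. \<Sum>s<N. g (rot (u s) z) * (chi N k ^ 0 / chi N k ^ s)) / of_nat N"
    by (simp add: ravg_def u_def sum_divide_distrib chi_power_swap)
  also have "(\<Sum>k<N. \<Sum>s<N. g (rot (u s) z) * (chi N k ^ 0 / chi N k ^ s))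
     = (\<Sum>s<N. g (rot (u s) z) * (\<Sum>k<N. chi N k ^ 0 / chi N k ^ s))"
    by (subst sum.swap) (simp add: sum_distrib_left)
  also have "\<dots> = (\<Sum>s<N. if s = 0 then g (rot (u s) z) * of_nat N else 0)"
    using N by (intro sum.cong) (auto simp: sum_chi simp del: power_0)
  also have "\<dots> = g z * of_nat N"
    using N by (simp add: u0)
  finally show ?thesis using N by simp
qed

text \<open>Starting from the all-ones point, the coordinates are replaced by those of
  \<open>z\<close> one at a time, each replacement being a scaling by z_i. Going in this direction
  covers points with vanishing coordinates.\<close>

lemma homog_in_all_eq_monomial:
  fixes g :: "complex ^ 'n::finite \<Rightarrow> complex"
  assumes "\<And>i. homog_in i (p i) g"
  shows "g z = g (\<chi> i. 1) * monomial_n p z"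
proof -
  have "g (\<chi> j. if j \<in> A then z $ j else 1) = g (\<chi> i. 1) * (\<Prod>i\<in>A. (z $ i) ^ p i)" if "finite A" for A
    using that
  proof (induction A)
    case (insert i A)
    define w :: "complex ^ 'n" where "w = (\<chi> j. if j \<in> A then z $ j else 1)"
    have "(\<chi> j. if j \<in> insert i A then z $ j else 1) = vec_upd w i (z $ i * w $ i)"
      using insert.hyps by (auto simp: vec_eq_iff vec_upd_nth w_def)
    then have "g (\<chi> j. if j \<in> insert i A then z $ j else 1) = (z $ i) ^ p i * g w"
      using assms[of i] by (simp add: homog_in_def)
    then show ?case
      using insert by (simp add: w_def)
  qed simp
  from this[of UNIV] show ?thesis
    by (simp add: monomial_n_def)
qed

section \<open>Spans in the space of functions and the splitting into square integrable
  monomials\<close>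

lemma vector_space_fscale: "vector_space (fscale :: complex \<Rightarrow> ('a \<Rightarrow> complex) \<Rightarrow> _)"
  by unfold_locales (auto simp: fscale_def fun_eq_iff algebra_simps)

interpretation fs: vector_space "fscale :: complex \<Rightarrow> ('a \<Rightarrow> complex) \<Rightarrow> _"
  by (rule vector_space_fscale)

lemma sum_fun_apply: "(\<Sum>i\<in>A. f i) x = (\<Sum>i\<in>A. f i x :: complex)"
  by (induction A rule: infinite_finite_induct) auto

text \<open>Averaging over the rotations of one coordinate at a time splits a separately polynomial function
  into pieces that are homogeneous in every coordinate, without losing square integrability.\<close>

lemma seppoly_decompose:
  fixes D :: "(complex ^ 'n::finite) set"
  assumes D: "rot_invariant D" "D \<in> sets borel" and N: "0 < N"
    and A: "finite A" and g: "seppoly N g" "homog d g" "sq_integrable D g"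
  shows "g \<in> cspan {h. seppoly N h \<and> homog d h \<and> sq_integrable D h \<and> (\<forall>i\<in>A. \<exists>k. homog_in i k h)}"
  using A g
proof (induction A arbitrary: g)
  case empty
  then show ?case by (intro fs.span_base) simp
next
  case (insert i A)
  let ?S = "\<lambda>A. {h. seppoly N h \<and> homog d h \<and> sq_integrable D h \<and> (\<forall>i\<in>A. \<exists>k. homog_in i k h)}"
  have "?S A \<subseteq> cspan (?S (insert i A))"
  proof
    fix h assume h: "h \<in> ?S A"
    have "h = (\<Sum>k<N. ravg N {i} k h)"
      by (rule ext) (simp add: sum_fun_apply sum_ravg[OF N])
    also have "\<dots> \<in> cspan (?S (insert i A))"
    proof (intro fs.span_sum fs.span_base CollectI conjI ballI)
      fix k j assume "k \<in> {..<N}" "j \<in> insert i A"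
      then show "\<exists>k'. homog_in j k' (ravg N {i} k h)"
        using h homog_in_ravg[of N h k i] homog_in_ravg_other[of j _ h N "{i}" k] by blast
    qed (use h seppoly_ravg homog_ravg sq_integrable_ravg D in blast)+
    finally show "h \<in> cspan (?S (insert i A))" .
  qed
  then have "cspan (?S A) \<subseteq> cspan (?S (insert i A))"
    by (rule fs.span_minimal) (rule fs.subspace_span)
  with insert.IH[OF insert.prems] show ?case by blast
qed

lemma homog_monomial_n: "monomial_n p (l *s z) = l ^ mi_length p * monomial_n p z"
  by (simp add: monomial_n_def mi_length_def power_mult_distrib prod.distrib power_sum)

lemma monomial_n_one [simp]: "monomial_n p (\<chi> i. 1) = 1"
  by (simp add: monomial_n_def)

lemma sq_integral_cmult:
  assumes c: "c \<noteq> 0" and "sq_integral D (\<lambda>z. c * g z) < \<infinity>"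
    and g: "(\<lambda>z. indicator D z * g z) \<in> borel_measurable borel"
  shows "sq_integral D g < \<infinity>"
proof -
  have [measurable]: "(\<lambda>z. ennreal ((cmod (g z))\<^sup>2) * indicator D z) \<in> borel_measurable borel"
  proof -
    have "ennreal ((cmod (g z))\<^sup>2) * indicator D z = ennreal ((cmod (indicator D z * g z))\<^sup>2)" for z
      by (simp add: indicator_def)
    then show ?thesis using g by simp
  qed
  have "sq_integral D (\<lambda>z. c * g z) = ennreal ((cmod c)\<^sup>2) * sq_integral D g"
    unfolding sq_integral_def
    by (subst nn_integral_cmult[symmetric]) (auto simp: norm_mult power_mult_distrib ennreal_mult mult.assoc)
  with assms(2) c show ?thesis
    by (auto simp: ennreal_mult_less_top)
qed

text \<open>A piece homogeneous in every coordinate is a multiple c z^p. If c is nonzero, the total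
  degree forces |p| = d, and the square integrability of the piece passes to z^p itself.\<close>

lemma seppoly_homog_in_span_monomials:
  fixes D :: "(complex ^ 'n::finite) set"
  assumes D: "rot_invariant D" "D \<in> sets borel" and N: "0 < N"
    and g: "seppoly N g" "homog d g" "sq_integrable D g"
  shows "g \<in> cspan {monomial_n p | p. mi_length p = d \<and> sq_integral D (monomial_n p) < \<infinity>}" (is "g \<in> cspan ?M")
proof -
  have "{h. seppoly N h \<and> homog d h \<and> sq_integrable D h \<and> (\<forall>i\<in>UNIV. \<exists>k. homog_in i k h)} \<subseteq> cspan ?M"
  proof
    fix h assume "h \<in> {h. seppoly N h \<and> homog d h \<and> sq_integrable D h \<and> (\<forall>i\<in>UNIV. \<exists>k. homog_in i k h)}"
    then have h: "homog d h" "sq_integrable D h" and "\<forall>i. \<exists>k. homog_in i k h" by auto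
    then obtain p where p: "\<And>i. homog_in i (p i) h" by metis
    define c where "c = h (\<chi> i. 1)"
    have eq: "h z = c * monomial_n p z" for z
      unfolding c_def by (rule homog_in_all_eq_monomial[OF p])
    have h_eq: "h = fscale c (monomial_n p)"
      by (rule ext) (simp add: eq fscale_def)
    \<comment> \<open>If c = 0, the exponents \<open>p\<close> are not determined by
      \<open>h\<close> and the monomial may fail to be admissible; the piece is then zero and lies
      in every span.\<close>
    show "h \<in> cspan ?M"
    proof (cases "c = 0")
      case True
      then show ?thesis unfolding h_eq by (simp add: fs.span_zero)
    next
      case False
      \<comment> \<open>At twice the all-ones point the two homogeneities give 2^|p| = 2^d, which
        identifies the exponents.\<close>
      have "h (2 *s (\<chi> i. 1)) = 2 ^ d * h (\<chi> i. 1)" using h(1) by (simp add: homog_def)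
      then have "(2::complex) ^ mi_length p = 2 ^ d"
        using False by (simp add: eq homog_monomial_n)
      then have "cmod (2 ^ mi_length p) = cmod (2 ^ d)" by simp
      then have len: "mi_length p = d" by (simp add: norm_power)
      have "sq_integral D (monomial_n p) < \<infinity>"
      proof (rule sq_integral_cmult[OF False])
        have "h = (\<lambda>z. c * monomial_n p z)" by (rule ext) (rule eq)
        then show "sq_integral D (\<lambda>z. c * monomial_n p z) < \<infinity>"
          using h(2) by (simp only: sq_integrable_def)
        show "(\<lambda>z. indicator D z * monomial_n p z) \<in> borel_measurable borel"
          using D(2) by measurable
      qed
      then show ?thesis
        unfolding h_eq using len by (intro fs.span_scale fs.span_base) auto
    qed
  qed
  then have "cspan {h. seppoly N h \<and> homog d h \<and> sq_integrable D h \<and> (\<forall>i\<in>UNIV. \<exists>k. homog_in i k h)} \<subseteq> cspan ?M"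
    by (rule fs.span_minimal) (rule fs.subspace_span)
  with seppoly_decompose[OF D N _ g, of UNIV] show ?thesis by auto
qed


section \<open>The homogeneous parts are separately polynomial and square integrable\<close>

context balanced_holomorphic
begin

lemma seppoly_hcoef: "seppoly (Suc d) (hcoef f d)"
  unfolding seppoly_def
proof (intro allI)
  fix z :: "complex ^ 'n" and i
  obtain C where C: "\<And>z. norm (hcoef f d z) \<le> C * norm z ^ d"
    using hcoef_growth by blast
  define u where "u = vec_upd z i 0"
  define q where "q = (\<lambda>l. hcoef f d (u + l *s axis i 1))"
  have upd: "vec_upd z i l = u + l *s axis i 1" for l
    by (simp add: vec_eq_iff vec_upd_nth u_def axis_def)
  have "q holomorphic_on UNIV"
    unfolding q_def by (rule hcoef_holomorphic_line)
  \<comment> \<open>Liouville asks for growth at large l only. From |l| \<ge> |u| on, |u + l e_i|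
    \<le> 2 |l|, whence the factor 2^d. The sign of \<open>C\<close> is unknown, hence its absolute
    value.\<close>
  moreover have "norm (q l) \<le> (\<bar>C\<bar> * 2 ^ d) * norm l ^ d" if "norm u \<le> norm l" for l
  proof -
    have "norm (u + l *s axis i 1) \<le> norm u + norm (l *s (axis i 1 :: complex ^ 'n))"
      by (rule norm_triangle_ineq)
    also have "\<dots> \<le> 2 * norm l"
      using that by (simp add: norm_vector_scalar_mult)
    finally have "C * norm (u + l *s axis i 1) ^ d \<le> \<bar>C\<bar> * (2 * norm l) ^ d"
      by (intro mult_mono power_mono) auto
    with C[of "u + l *s axis i 1"] show ?thesis
      by (simp add: q_def power_mult_distrib mult.assoc)
  qed
  ultimately have "q l = (\<Sum>k\<le>d. (deriv ^^ k) q 0 / fact k * l ^ k)" for l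
    by (rule Liouville_polynomial)
  moreover have "hcoef f d (vec_upd z i l) = q l" for l
    unfolding upd q_def ..
  ultimately show "\<exists>c. \<forall>l. hcoef f d (vec_upd z i l) = (\<Sum>j<Suc d. c j * l ^ j)"
    unfolding lessThan_Suc_atMost
    by (intro exI[of _ "\<lambda>k. (deriv ^^ k) q 0 / fact k"] allI) simp
qed

lemma homog_hcoef: "homog d (hcoef f d)"
  by (simp add: homog_def hcoef_scale)

text \<open>The averages converge pointwise on \<open>D\<close> without a dominating function at
  hand, but their norms are bounded by that of \<open>f\<close>. Fatou's lemma turns this into
  finiteness for the limit.\<close>

lemma sq_integrable_hcoef:
  assumes D: "rot_invariant D" and f: "sq_integrable D f"
  shows "sq_integrable D (hcoef f d)"
proof -
  have DB: "D \<in> sets borel" using open_D by (rule borel_open)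
  define h where "h = (\<lambda>N z. indicator D z * ravg N UNIV d f z)"
  have h: "h N \<in> borel_measurable borel" for N
    using sq_integrable_ravg[OF D DB f, of N UNIV d] by (simp add: sq_integrable_def h_def)
  have lim: "(\<lambda>N. h N z) \<longlonglongrightarrow> indicator D z * hcoef f d z" for z
  proof (cases "z \<in> D")
    case True
    then show ?thesis using ravg_tendsto_hcoef[OF True] by (simp add: h_def)
  qed (simp add: h_def)
  have sq: "ennreal ((cmod (g z))\<^sup>2) * indicator D z = ennreal ((cmod (indicator D z * g z))\<^sup>2)" for g :: "complex ^ 'n \<Rightarrow> complex" and z
    by (simp add: indicator_def)
  have "sq_integral D (hcoef f d) = (\<integral>\<^sup>+z. liminf (\<lambda>N. ennreal ((cmod (h N z))\<^sup>2)) \<partial>lborel)"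
    unfolding sq_integral_def sq
    by (intro nn_integral_cong lim_imp_Liminf[symmetric] tendsto_ennrealI tendsto_power tendsto_norm lim) simp
  also have "\<dots> \<le> liminf (\<lambda>N. \<integral>\<^sup>+z. ennreal ((cmod (h N z))\<^sup>2) \<partial>lborel)"
    using h by (intro nn_integral_liminf) measurable
  also have "\<dots> \<le> liminf (\<lambda>N::nat. sq_integral D f)"
  proof (intro Liminf_mono always_eventually allI)
    fix N
    have "(\<integral>\<^sup>+z. ennreal ((cmod (h N z))\<^sup>2) \<partial>lborel) = sq_integral D (ravg N UNIV d f)"
      unfolding sq_integral_def sq h_def ..
    also have "\<dots> \<le> sq_integral D f"
      using f by (intro sq_integral_ravg_le D DB) (simp add: sq_integrable_def)
    finally show "(\<integral>\<^sup>+z. ennreal ((cmod (h N z))\<^sup>2) \<partial>lborel) \<le> sq_integral D f" .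
  qed
  also have "\<dots> = sq_integral D f" by (simp add: Liminf_const)
  also have "\<dots> < \<infinity>" using f by (simp add: sq_integrable_def)
  finally show ?thesis
    using borel_measurable_LIMSEQ_metric[OF h lim] by (simp add: sq_integrable_def)
qed

end

section \<open>The Bergman space\<close>

lemma indicator_mult_borel:
  fixes f :: "complex ^ 'n::finite \<Rightarrow> complex"
  assumes "open D" "continuous_on D f"
  shows "(\<lambda>z. indicator D z * f z) \<in> borel_measurable borel"
proof -
  have "(\<lambda>z. indicator D z *\<^sub>R f z) \<in> borel_measurable borel"
    using assms by (intro borel_measurable_continuous_on_indicator) auto
  moreover have "(\<lambda>z. indicator D z *\<^sub>R f z) = (\<lambda>z. indicator D z * f z)"
    by (auto simp: indicator_def)
  ultimately show ?thesis by simp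
qed

text \<open>Links integrability over the completed measure, as in \<open>bergman_space\<close>, to
  the \<open>ennreal\<close> integral over \<open>lborel\<close> in which the estimates are made.
  Continuity on an open set makes the truncated function Borel, so completion changes
  nothing.\<close>

lemma set_integrable_iff_sq_integral:
  assumes "open D" "continuous_on D f"
  shows "set_integrable lebesgue D (\<lambda>z. (cmod (f z))\<^sup>2) \<longleftrightarrow> sq_integral D f < \<infinity>"
proof -
  have eq: "(\<lambda>z. indicator D z *\<^sub>R (cmod (f z))\<^sup>2) = (\<lambda>z. (cmod (indicator D z * f z))\<^sup>2)"
    by (auto simp: indicator_def)
  have [measurable]: "(\<lambda>z. (cmod (indicator D z * f z))\<^sup>2) \<in> borel_measurable borel"
    using indicator_mult_borel[OF assms] by measurable
  have "set_integrable lebesgue D (\<lambda>z. (cmod (f z))\<^sup>2) \<longleftrightarrow> integrable lborel (\<lambda>z. (cmod (indicator D z * f z))\<^sup>2)"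
    unfolding set_integrable_def eq by (rule integrable_completion) simp
  also have "\<dots> \<longleftrightarrow> (\<integral>\<^sup>+z. ennreal ((cmod (indicator D z * f z))\<^sup>2) \<partial>lborel) < \<infinity>"
    by (simp add: integrable_iff_bounded)
  also have "(\<integral>\<^sup>+z. ennreal ((cmod (indicator D z * f z))\<^sup>2) \<partial>lborel) = sq_integral D f"
    unfolding sq_integral_def by (intro nn_integral_cong) (simp add: indicator_def)
  finally show ?thesis .
qed

lemma mem_bergman_space_iff:
  "f \<in> bergman_space D \<longleftrightarrow> holomorphic_n f D \<and> sq_integral D f < \<infinity> \<and> (\<forall>z. z \<notin> D \<longrightarrow> f z = 0)"
  using set_integrable_iff_sq_integral[of D f] holomorphic_n_imp_continuous_on[of f D]
  unfolding bergman_space_def holomorphic_n_def by auto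

text \<open>Scaling by |l| \<le> 1 multiplies the left side of each condition by |l|^2, and it can
  only increase the right side, which for a > 0 decreases in |z_m|.\<close>

lemma balanced_holomorphic_domD:
  fixes f :: "complex ^ 'n::finite \<Rightarrow> complex"
  assumes a: "0 < a" and f: "holomorphic_n f (domD a m)"
  shows "balanced_holomorphic (domD a m) f"
proof
  show "0 \<in> domD a m" by (simp add: domD_def)
  fix z :: "complex ^ 'n" and l :: complex
  assume z: "z \<in> domD a m" and l: "cmod l \<le> 1"
  have l2: "(cmod l)\<^sup>2 \<le> 1" using l by (simp add: power_le_one)
  show "l *s z \<in> domD a m"
    unfolding domD_def
  proof (intro CollectI allI impI)
    fix k assume "k \<noteq> m"
    have le: "(cmod l)\<^sup>2 * x \<le> x" if "0 \<le> x" for x :: real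
      using mult_right_mono[OF l2 that] by simp
    have "\<bar>(cmod ((l *s z) $ k))\<^sup>2 - (cmod ((l *s z) $ m))\<^sup>2\<bar> = (cmod l)\<^sup>2 * \<bar>(cmod (z $ k))\<^sup>2 - (cmod (z $ m))\<^sup>2\<bar>"
      by (simp add: norm_mult power_mult_distrib right_diff_distrib[symmetric] abs_mult)
    also have "\<dots> \<le> \<bar>(cmod (z $ k))\<^sup>2 - (cmod (z $ m))\<^sup>2\<bar>"
      by (rule le) simp
    also have "\<dots> < 1 / ((cmod (z $ m))\<^sup>2 + 1) powr a"
      using z \<open>k \<noteq> m\<close> by (simp add: domD_def)
    also have "\<dots> \<le> 1 / ((cmod ((l *s z) $ m))\<^sup>2 + 1) powr a"
    proof (intro divide_left_mono powr_mono2)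
      show "(cmod ((l *s z) $ m))\<^sup>2 + 1 \<le> (cmod (z $ m))\<^sup>2 + 1"
        using le[of "(cmod (z $ m))\<^sup>2"] by (simp add: norm_mult power_mult_distrib)
      have "0 < (cmod ((l *s z) $ m))\<^sup>2 + 1" "0 < (cmod (z $ m))\<^sup>2 + 1"
        by (auto intro: add_nonneg_pos)
      then show "0 < ((cmod (z $ m))\<^sup>2 + 1) powr a * ((cmod ((l *s z) $ m))\<^sup>2 + 1) powr a"
        by simp
    qed (use a in auto)
    finally show "\<bar>(cmod ((l *s z) $ k))\<^sup>2 - (cmod ((l *s z) $ m))\<^sup>2\<bar> < 1 / ((cmod ((l *s z) $ m))\<^sup>2 + 1) powr a" .
  qed
qed (rule f)

text \<open>Realises the normalisation that elements of the Bergman space vanish off the domain.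
  Truncation is linear, so it carries spans of monomials to spans of truncated ones.\<close>

definition restr :: "'a set \<Rightarrow> ('a \<Rightarrow> complex) \<Rightarrow> 'a \<Rightarrow> complex" where
  "restr D g = (\<lambda>z. if z \<in> D then g z else 0)"

lemma restr_span: "g \<in> cspan S \<Longrightarrow> restr D g \<in> cspan (restr D ` S)"
proof (induction rule: fs.span_induct_alt)
  case base
  have e: "restr D 0 = 0" by (auto simp: restr_def)
  show ?case unfolding e by (rule fs.span_zero)
next
  case (step c x y)
  have e: "restr D (fscale c x + y) = fscale c (restr D x) + restr D y"
    by (auto simp: restr_def fscale_def)
  show ?case
    unfolding e using step by (intro fs.span_add fs.span_scale) (auto intro: fs.span_base)
qed

text \<open>Beyond the critical degree no monomial is square integrable, so the homogeneous parts
  vanish and the expansion of \<open>f\<close> is a finite sum. This is why the algebraic span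
  suffices.\<close>

lemma bergman_space_domD_subset_span:
  fixes m :: "'n::finite"
  assumes a: "0 < a" and f: "f \<in> bergman_space (domD a m)"
  shows "f \<in> cspan {restr (domD a m) (monomial_n p) | p. real (mi_length p) < (real CARD('n) - 1) * a - 1}"
    (is "f \<in> cspan ?B")
proof -
  let ?D = "domD a m" and ?b = "(real CARD('n) - 1) * a - 1"
  have f': "holomorphic_n f ?D" "sq_integral ?D f < \<infinity>" "\<And>z. z \<notin> ?D \<Longrightarrow> f z = 0"
    using f by (auto simp: mem_bergman_space_iff)
  interpret balanced_holomorphic ?D f
    using a f'(1) by (rule balanced_holomorphic_domD)
  have sq: "sq_integrable ?D f"
    using indicator_mult_borel[OF open_D holomorphic_n_imp_continuous_on[OF holo]] f'(2)
    by (simp add: sq_integrable_def)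
  \<comment> \<open>The bound on \<open>d\<close> is built into the set, so that it is empty, with
    span zero, as soon as \<open>d\<close> reaches the critical degree.\<close>
  let ?M = "\<lambda>d. {monomial_n p | p :: 'n \<Rightarrow> nat. mi_length p = d \<and> real d < ?b}"
  have mem: "hcoef f d \<in> cspan (?M d)" for d
  proof -
    have "hcoef f d \<in> cspan {monomial_n p | p. mi_length p = d \<and> sq_integral ?D (monomial_n p) < \<infinity>}"
      using seppoly_homog_in_span_monomials[OF rot_invariant_domD domD_borel zero_less_Suc seppoly_hcoef
        homog_hcoef sq_integrable_hcoef[OF rot_invariant_domD sq]] .
    moreover have "{monomial_n p | p. mi_length p = d \<and> sq_integral ?D (monomial_n p) < \<infinity>} \<subseteq> ?M d"
      using sq_integral_monomial_n_infinite[OF a, of _ m] by (force simp: not_less[symmetric])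
    ultimately show ?thesis using fs.span_mono by blast
  qed
  \<comment> \<open>The least natural number not below the bound; it is 0 when the bound is at most
    0, and then the sum is empty.\<close>
  define K where "K = nat \<lceil>?b\<rceil>"
  have zero: "hcoef f d z = 0" if "K \<le> d" for d z
  proof -
    have "?b \<le> real d" using that unfolding K_def by linarith
    then have e: "?M d = {}" by auto
    show ?thesis using mem[of d] unfolding e fs.span_empty by simp
  qed
  have f_eq: "f = restr ?D (\<Sum>d<K. hcoef f d)"
  proof
    fix z
    show "f z = restr ?D (\<Sum>d<K. hcoef f d) z"
    proof (cases "z \<in> ?D")
      case True
      from hcoef_sums[OF True, of 1] have "(\<lambda>d. hcoef f d z) sums f z" by simp
      moreover have "(\<lambda>d. hcoef f d z) sums (\<Sum>d<K. hcoef f d z)"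
        using zero by (intro sums_finite) auto
      ultimately have "f z = (\<Sum>d<K. hcoef f d z)" by (rule sums_unique2)
      then show ?thesis using True by (simp add: restr_def sum_fun_apply)
    qed (simp add: restr_def f'(3))
  qed
  have sum_mem: "(\<Sum>d<K. hcoef f d) \<in> cspan {monomial_n p | p. real (mi_length p) < ?b}"
  proof (rule fs.span_sum)
    fix d
    have "?M d \<subseteq> {monomial_n p | p. real (mi_length p) < ?b}" by blast
    from subsetD[OF fs.span_mono[OF this] mem]
    show "hcoef f d \<in> cspan {monomial_n p | p. real (mi_length p) < ?b}" .
  qed
  have B: "restr ?D ` {monomial_n p | p. real (mi_length p) < ?b} = ?B"
    by (simp only: setcompr_eq_image image_image)
  show ?thesis
    using restr_span[OF sum_mem, of ?D] unfolding B f_eq[symmetric] .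
qed


section \<open>Truncated monomials and their combinations belong to the Bergman space\<close>

definition complex_diff_at :: "(complex ^ 'n::finite \<Rightarrow> complex) \<Rightarrow> complex ^ 'n \<Rightarrow> bool" where
  "complex_diff_at g z \<longleftrightarrow> (\<exists>L. (g has_derivative L) (at z) \<and> (\<forall>c v. L (c *s v) = c * L v))"

lemma complex_diff_at_const: "complex_diff_at (\<lambda>z. c) z"
  unfolding complex_diff_at_def by (intro exI[of _ "\<lambda>_. 0"]) auto

lemma complex_diff_at_nth: "complex_diff_at (\<lambda>z. z $ i) z"
  unfolding complex_diff_at_def
  by (intro exI[of _ "\<lambda>v. v $ i"]) (auto intro: bounded_linear_imp_has_derivative bounded_linear_vec_nth)

lemma complex_diff_at_add:
  assumes "complex_diff_at f z" "complex_diff_at g z"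
  shows "complex_diff_at (\<lambda>z. f z + g z) z"
proof -
  obtain L M where "(f has_derivative L) (at z)" "\<forall>c v. L (c *s v) = c * L v"
    "(g has_derivative M) (at z)" "\<forall>c v. M (c *s v) = c * M v"
    using assms unfolding complex_diff_at_def by blast
  then show ?thesis
    unfolding complex_diff_at_def
    by (intro exI[of _ "\<lambda>v. L v + M v"]) (auto intro: has_derivative_add simp: algebra_simps)
qed

lemma complex_diff_at_mult:
  assumes "complex_diff_at f z" "complex_diff_at g z"
  shows "complex_diff_at (\<lambda>z. f z * g z) z"
proof -
  obtain L M where L: "(f has_derivative L) (at z)" "\<And>c v. L (c *s v) = c * L v"
    and M: "(g has_derivative M) (at z)" "\<And>c v. M (c *s v) = c * M v"
    using assms unfolding complex_diff_at_def by blast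
  show ?thesis
    unfolding complex_diff_at_def
    by (rule exI, intro conjI, rule has_derivative_mult[OF L(1) M(1)])
       (simp add: L(2) M(2) algebra_simps)
qed

lemma complex_diff_at_power:
  assumes "complex_diff_at f z"
  shows "complex_diff_at (\<lambda>z. f z ^ k) z"
  by (induction k) (simp_all add: complex_diff_at_const complex_diff_at_mult assms)

lemma complex_diff_at_prod:
  assumes "\<And>i. i \<in> A \<Longrightarrow> complex_diff_at (f i) z"
  shows "complex_diff_at (\<lambda>z. \<Prod>i\<in>A. f i z) z"
  using assms by (induction A rule: infinite_finite_induct) (simp_all add: complex_diff_at_const complex_diff_at_mult)

lemma complex_diff_at_monomial_n: "complex_diff_at (monomial_n p) z"
  unfolding monomial_n_def by (intro complex_diff_at_prod complex_diff_at_power complex_diff_at_nth)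

lemma holomorphic_n_iff: "holomorphic_n f D \<longleftrightarrow> open D \<and> (\<forall>z\<in>D. complex_diff_at f z)"
  by (simp add: holomorphic_n_def complex_diff_at_def)

text \<open>Since \<open>D\<close> is open, the truncation agrees with \<open>g\<close> near every
  point of \<open>D\<close> and has the same derivative there.\<close>

lemma holomorphic_n_restr:
  assumes "open D" "\<And>z. z \<in> D \<Longrightarrow> complex_diff_at g z"
  shows "holomorphic_n (restr D g) D"
  unfolding holomorphic_n_def
proof (intro conjI ballI)
  fix z assume z: "z \<in> D"
  with assms(2) obtain L where L: "(g has_derivative L) (at z)" "\<forall>c v. L (c *s v) = c * L v"
    unfolding complex_diff_at_def by blast
  have "(restr D g has_derivative L) (at z)"
    using L(1) assms(1) z by (rule has_derivative_transform_within_open) (simp add: restr_def)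
  with L(2) show "\<exists>L. (restr D g has_derivative L) (at z) \<and> (\<forall>c v. L (c *s v) = c * L v)"
    by blast
qed (rule assms)

lemma sq_integral_restr: "sq_integral D (restr D g) = sq_integral D g"
  unfolding sq_integral_def by (intro nn_integral_cong) (simp add: restr_def indicator_def)

lemma sq_integral_scale: "sq_integral D f < \<infinity> \<Longrightarrow> open D \<Longrightarrow> continuous_on D f \<Longrightarrow>
  sq_integral D (\<lambda>z. c * f z) < \<infinity>"
  by (subst (asm) set_integrable_iff_sq_integral[symmetric], assumption, assumption,
      subst set_integrable_iff_sq_integral[symmetric])
     (auto simp: norm_mult power_mult_distrib intro: continuous_intros)

lemma sq_integral_add:
  assumes "open D" "continuous_on D f" "continuous_on D g" "sq_integral D f < \<infinity>" "sq_integral D g < \<infinity>"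
  shows "sq_integral D (\<lambda>z. f z + g z) < \<infinity>"
proof -
  have meas: "(\<lambda>z. ennreal ((cmod (h z))\<^sup>2) * indicator D z) \<in> borel_measurable borel"
    if "continuous_on D h" for h :: "complex ^ 'a \<Rightarrow> complex"
  proof -
    have "ennreal ((cmod (h z))\<^sup>2) * indicator D z = ennreal ((cmod (indicator D z * h z))\<^sup>2)" for z
      by (simp add: indicator_def)
    then show ?thesis using indicator_mult_borel[OF assms(1) that] by simp
  qed
  have "(cmod (x + y))\<^sup>2 \<le> 2 * (cmod x)\<^sup>2 + 2 * (cmod y)\<^sup>2" for x y
  proof -
    have "(cmod (x + y))\<^sup>2 \<le> (cmod x + cmod y)\<^sup>2"
      by (intro power_mono norm_triangle_ineq) simp
    also have "\<dots> \<le> 2 * (cmod x)\<^sup>2 + 2 * (cmod y)\<^sup>2"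
      using sum_squares_bound[of "cmod x" "cmod y"] by (simp add: power2_sum)
    finally show ?thesis .
  qed
  then have le: "ennreal ((cmod (x + y))\<^sup>2) \<le> 2 * ennreal ((cmod x)\<^sup>2) + 2 * ennreal ((cmod y)\<^sup>2)" for x y
    using ennreal_leI[of "(cmod (x + y))\<^sup>2" "2 * (cmod x)\<^sup>2 + 2 * (cmod y)\<^sup>2"]
    by (simp add: ennreal_mult')
  have "sq_integral D (\<lambda>z. f z + g z) \<le>
     (\<integral>\<^sup>+z. 2 * (ennreal ((cmod (f z))\<^sup>2) * indicator D z) + 2 * (ennreal ((cmod (g z))\<^sup>2) * indicator D z) \<partial>lborel)"
    unfolding sq_integral_def
    by (intro nn_integral_mono) (simp add: indicator_def le)
  also have "\<dots> = 2 * sq_integral D f + 2 * sq_integral D g"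
    using meas[OF assms(2)] meas[OF assms(3)]
    by (simp add: nn_integral_add nn_integral_cmult sq_integral_def)
  also have "\<dots> < \<infinity>"
    using assms(4,5) by (simp add: ennreal_mult_less_top)
  finally show ?thesis .
qed

lemma subspace_bergman_space:
  assumes D: "open D"
  shows "fs.subspace (bergman_space D)"
proof (rule fs.subspaceI)
  show "0 \<in> bergman_space D"
    using D by (simp add: mem_bergman_space_iff holomorphic_n_iff sq_integral_def zero_fun_def complex_diff_at_const)
next
  fix f g assume "f \<in> bergman_space D" "g \<in> bergman_space D"
  then have f: "holomorphic_n f D" "sq_integral D f < \<infinity>" "\<And>z. z \<notin> D \<Longrightarrow> f z = 0"
    and g: "holomorphic_n g D" "sq_integral D g < \<infinity>" "\<And>z. z \<notin> D \<Longrightarrow> g z = 0"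
    by (auto simp: mem_bergman_space_iff)
  have "f + g = (\<lambda>z. f z + g z)" by (simp add: fun_eq_iff)
  then show "f + g \<in> bergman_space D"
    using f g D sq_integral_add[OF D holomorphic_n_imp_continuous_on[OF f(1)] holomorphic_n_imp_continuous_on[OF g(1)] f(2) g(2)]
    by (simp add: mem_bergman_space_iff holomorphic_n_iff complex_diff_at_add)
next
  fix c f assume "f \<in> bergman_space D"
  then have f: "holomorphic_n f D" "sq_integral D f < \<infinity>" "\<And>z. z \<notin> D \<Longrightarrow> f z = 0"
    by (auto simp: mem_bergman_space_iff)
  show "fscale c f \<in> bergman_space D"
    unfolding fscale_def
    using f D sq_integral_scale[OF f(2) D holomorphic_n_imp_continuous_on[OF f(1)], of c]
    by (simp add: mem_bergman_space_iff holomorphic_n_iff complex_diff_at_mult complex_diff_at_const)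
qed

lemma restr_monomial_n_in_bergman_space:
  fixes p :: "'n::finite \<Rightarrow> nat"
  assumes "0 < a" "real (mi_length p) < (real CARD('n) - 1) * a - 1"
  shows "restr (domD a m) (monomial_n p) \<in> bergman_space (domD a m)"
  unfolding mem_bergman_space_iff sq_integral_restr
proof (intro conjI allI impI)
  show "holomorphic_n (restr (domD a m) (monomial_n p)) (domD a m)"
    by (rule holomorphic_n_restr[OF open_domD complex_diff_at_monomial_n])
  show "sq_integral (domD a m) (monomial_n p) < \<infinity>"
    using assms by (rule sq_integral_monomial_n_finite)
qed (simp add: restr_def)

lemma bergman_space_domD_eq_span:
  fixes m :: "'n::finite"
  assumes a: "0 < a"
  shows "bergman_space (domD a m) =
    cspan {restr (domD a m) (monomial_n p) | p. real (mi_length p) < (real CARD('n) - 1) * a - 1}" (is "_ = cspan ?B")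
proof
  show "bergman_space (domD a m) \<subseteq> cspan ?B"
    using bergman_space_domD_subset_span[OF a] by blast
  have "?B \<subseteq> bergman_space (domD a m)"
    using restr_monomial_n_in_bergman_space[OF a] by blast
  then show "cspan ?B \<subseteq> bergman_space (domD a m)"
    by (rule fs.span_minimal[OF _ subspace_bergman_space[OF open_domD]])
qed

section \<open>Linear independence and dimension\<close>

text \<open>Independence is tested on the torus of N-th roots of unity, which lies in the domain.\<close>

lemma monomials_coeff_zero:
  fixes c :: "('n::finite \<Rightarrow> nat) \<Rightarrow> complex"
  assumes T: "finite T" and zero: "\<And>z. (\<And>i. cmod (z $ i) = 1) \<Longrightarrow> (\<Sum>p\<in>T. c p * monomial_n p z) = 0"
    and q: "q \<in> T"
  shows "c q = 0"
proof -
  \<comment> \<open>Larger than every exponent occurring in \<open>T\<close>, so that distinct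
    multi-indices of \<open>T\<close> stay distinct mod N.\<close>
  define N where "N = Suc (\<Sum>p\<in>T. \<Sum>i\<in>UNIV. p i)"
  have less: "p i < N" if "p \<in> T" for p i
  proof -
    have "p i \<le> (\<Sum>i\<in>UNIV. p i)" by (rule member_le_sum) auto
    also have "\<dots> \<le> (\<Sum>p\<in>T. \<Sum>i\<in>UNIV. p i)" using T that by (intro member_le_sum) auto
    finally show ?thesis by (simp add: N_def)
  qed
  have N: "0 < N" by (simp add: N_def)
  define P where "P = PiE (UNIV :: 'n set) (\<lambda>_. {..<N})"
  \<comment> \<open>The discrete inner product of z^p with z^q over the finite torus. Dividing by
    z^q replaces conjugation, as all values have modulus 1. The sum factors over the
    coordinates.\<close>
  have orth: "(\<Sum>s\<in>P. monomial_n p (\<chi> i. chi N (s i)) / (\<Prod>i\<in>UNIV. chi N (s i) ^ q i))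
     = (if p = q then of_nat N ^ CARD('n) else 0)" if p: "p \<in> T" for p
  proof -
    have "(\<Sum>s\<in>P. monomial_n p (\<chi> i. chi N (s i)) / (\<Prod>i\<in>UNIV. chi N (s i) ^ q i))
      = (\<Sum>s\<in>P. \<Prod>i\<in>UNIV. chi N (s i) ^ p i / chi N (s i) ^ q i)"
      by (simp add: monomial_n_def prod_dividef)
    also have "\<dots> = (\<Prod>i\<in>UNIV. \<Sum>k<N. chi N k ^ p i / chi N k ^ q i)"
      unfolding P_def by (rule prod_sum_PiE[symmetric]) auto
    also have "\<dots> = (\<Prod>i\<in>UNIV. if p i = q i then of_nat N else 0)"
      using less[OF p] less[OF q] N by (intro prod.cong) (auto simp: sum_chi)
    also have "\<dots> = (if p = q then of_nat N ^ CARD('n) else 0)"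
    proof (cases "p = q")
      case False
      then obtain i where "p i \<noteq> q i" by auto
      then have "(\<Prod>i\<in>UNIV. if p i = q i then of_nat N else 0) = (0::complex)"
        by (intro prod_zero bexI[of _ i]) auto
      then show ?thesis using False by simp
    qed simp
    finally show ?thesis .
  qed
  have "0 = (\<Sum>s\<in>P. (\<Sum>p\<in>T. c p * monomial_n p (\<chi> i. chi N (s i))) / (\<Prod>i\<in>UNIV. chi N (s i) ^ q i))"
    by (subst zero) auto
  also have "\<dots> = (\<Sum>p\<in>T. c p * (\<Sum>s\<in>P. monomial_n p (\<chi> i. chi N (s i)) / (\<Prod>i\<in>UNIV. chi N (s i) ^ q i)))"
    by (simp add: sum_divide_distrib sum_distrib_left) (rule sum.swap)
  also have "\<dots> = (\<Sum>p\<in>T. if p = q then c p * of_nat N ^ CARD('n) else 0)"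
    by (intro sum.cong) (auto simp: orth)
  also have "\<dots> = c q * of_nat N ^ CARD('n)"
    using T q by simp
  finally show ?thesis using N by simp
qed

lemma torus_in_domD: "(\<And>i. cmod (z $ i) = 1) \<Longrightarrow> z \<in> domD a m"
  by (simp add: domD_def)

text \<open>Equal truncations would give the relation z^p - z^q = 0 with leading coefficient 1.
  Injectivity lets sums and cardinalities over sets of functions be computed over exponents.\<close>

lemma inj_restr_monomial_n:
  fixes m :: "'n::finite"
  shows "inj (\<lambda>p. restr (domD a m) (monomial_n p))"
proof (rule injI, rule ccontr)
  fix p q :: "'n \<Rightarrow> nat"
  assume eq: "restr (domD a m) (monomial_n p) = restr (domD a m) (monomial_n q)" and ne: "p \<noteq> q"
  define c :: "('n \<Rightarrow> nat) \<Rightarrow> complex" where "c = (\<lambda>r. if r = p then 1 else -1)"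
  have "c p = 0"
  proof (rule monomials_coeff_zero[of "{p, q}"])
    fix z :: "complex ^ 'n" assume "\<And>i. cmod (z $ i) = 1"
    then have "z \<in> domD a m" by (rule torus_in_domD)
    with fun_cong[OF eq, of z] have "monomial_n p z = monomial_n q z" by (simp add: restr_def)
    then show "(\<Sum>r\<in>{p, q}. c r * monomial_n r z) = 0"
      using ne by (simp add: c_def)
  qed auto
  then show False by (simp add: c_def)
qed

lemma independent_restr_monomial_n:
  fixes m :: "'n::finite"
  shows "\<not> fs.dependent ((\<lambda>p. restr (domD a m) (monomial_n p)) ` S)"
  unfolding fs.independent_explicit_module
proof (intro allI impI)
  let ?r = "\<lambda>p. restr (domD a m) (monomial_n p)"
  fix t u v assume t: "finite t" "t \<subseteq> ?r ` S" and zero: "(\<Sum>v\<in>t. fscale (u v) v) = 0" and v: "v \<in> t"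
  obtain T where T: "T \<subseteq> S" "finite T" "t = ?r ` T"
    using finite_subset_image[OF t] by blast
  have sum: "(\<Sum>p\<in>T. fscale (u (?r p)) (?r p)) = 0"
    using zero unfolding T(3) by (subst (asm) sum.reindex) (auto intro: inj_on_subset[OF inj_restr_monomial_n] simp: o_def)
  obtain q where q: "q \<in> T" "v = ?r q" using v T(3) by blast
  have "u (?r q) = 0"
  proof (rule monomials_coeff_zero[of T "\<lambda>p. u (?r p)"])
    fix z :: "complex ^ 'n" assume "\<And>i. cmod (z $ i) = 1"
    then have "z \<in> domD a m" by (rule torus_in_domD)
    with fun_cong[OF sum, of z] show "(\<Sum>p\<in>T. u (?r p) * monomial_n p z) = 0"
      by (simp add: sum_fun_apply fscale_def restr_def)
  qed (use T q in auto)
  then show "u v = 0" using q by simp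
qed

text \<open>Splitting off the exponent j of the new coordinate leaves total degree at most k - j for
  the others. After reversing j, the sum of the counts is the hockey-stick identity. Vanishing off
  \<open>A\<close> makes \<open>p\<close> determined by its values on \<open>A\<close>.\<close>

lemma card_multiindices:
  assumes "finite A"
  shows "finite {p :: 'a \<Rightarrow> nat. (\<forall>i. i \<notin> A \<longrightarrow> p i = 0) \<and> (\<Sum>i\<in>A. p i) \<le> k} \<and>
    card {p :: 'a \<Rightarrow> nat. (\<forall>i. i \<notin> A \<longrightarrow> p i = 0) \<and> (\<Sum>i\<in>A. p i) \<le> k} = (card A + k) choose k"
  using assms
proof (induction A arbitrary: k rule: finite_induct)
  case empty
  have "{p :: 'a \<Rightarrow> nat. \<forall>i. p i = 0} = {\<lambda>_. 0}" by auto
  then show ?case by simp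
next
  case (insert x A)
  define S where "S = (\<lambda>A k. {p :: 'a \<Rightarrow> nat. (\<forall>i. i \<notin> A \<longrightarrow> p i = 0) \<and> (\<Sum>i\<in>A. p i) \<le> k})"
  define h where "h = (\<lambda>(j::nat, p :: 'a \<Rightarrow> nat). p(x := j))"
  have IH: "finite (S A k)" "card (S A k) = (card A + k) choose k" for k
    using insert.IH[of k] by (auto simp: S_def)
  have sum_upd: "(\<Sum>i\<in>A. (p(x := j)) i) = (\<Sum>i\<in>A. p i)" for p :: "'a \<Rightarrow> nat" and j
    using insert.hyps by (intro sum.cong) auto
  have "bij_betw h (SIGMA j:{..k}. S A (k - j)) (S (insert x A) k)"
  proof (rule bij_betw_byWitness[where f' = "\<lambda>p. (p x, p(x := 0))"])
    show "\<forall>a\<in>SIGMA j:{..k}. S A (k - j). (\<lambda>p. (p x, p(x := 0))) (h a) = a"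
      using insert.hyps by (auto simp: h_def S_def fun_eq_iff)
    show "\<forall>p\<in>S (insert x A) k. h (p x, p(x := 0)) = p"
      by (simp add: h_def)
    show "h ` (SIGMA j:{..k}. S A (k - j)) \<subseteq> S (insert x A) k"
      using insert.hyps by (auto simp: h_def S_def sum_upd simp del: fun_upd_apply) auto
    show "(\<lambda>p. (p x, p(x := 0))) ` S (insert x A) k \<subseteq> (SIGMA j:{..k}. S A (k - j))"
      using insert.hyps by (auto simp: S_def sum_upd simp del: fun_upd_apply) auto
  qed
  then have "finite (S (insert x A) k)" "card (S (insert x A) k) = card (SIGMA j:{..k}. S A (k - j))"
    using bij_betw_finite bij_betw_same_card IH(1) by (metis finite_SigmaI finite_atMost)+
  moreover have "card (SIGMA j:{..k}. S A (k - j)) = (\<Sum>j\<le>k. (card A + (k - j)) choose (k - j))"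
    using IH by (subst card_SigmaI) auto
  moreover have "\<dots> = (\<Sum>j\<le>k. (card A + j) choose j)"
    using sum.atLeastAtMost_rev[of "\<lambda>j. (card A + j) choose j" 0 k] by (simp add: atMost_atLeast0)
  moreover have "\<dots> = Suc (card A + k) choose k"
    by (rule sum_choose_lower)
  ultimately show ?case
    using insert.hyps unfolding S_def by simp
qed

lemma cdim_span_restr_monomial_n:
  fixes m :: "'n::finite"
  shows "cdim (cspan {restr (domD a m) (monomial_n p) | p. mi_length p \<le> k}) = (CARD('n) + k) choose k"
proof -
  have eq: "{restr (domD a m) (monomial_n p) | p. mi_length p \<le> k} = (\<lambda>p. restr (domD a m) (monomial_n p)) ` {p. mi_length p \<le> k}"
    by (rule setcompr_eq_image)
  have "cdim (cspan {restr (domD a m) (monomial_n p) | p. mi_length p \<le> k})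
    = card ((\<lambda>p. restr (domD a m) (monomial_n p)) ` {p. mi_length p \<le> k})"
    unfolding eq by (rule fs.dim_span_eq_card_independent[OF independent_restr_monomial_n])
  also have "\<dots> = card {p :: 'n \<Rightarrow> nat. mi_length p \<le> k}"
    by (intro card_image inj_on_subset[OF inj_restr_monomial_n]) simp
  also have "\<dots> = (CARD('n) + k) choose k"
    using card_multiindices[of "UNIV :: 'n set" k] by (simp add: mi_length_def)
  finally show ?thesis .
qed

theorem theorem2p1:
  fixes a :: real and m :: "'n::finite"
  assumes n2: "CARD('n) \<ge> 2" and apos: "a > 0"
  shows "(a > 1 / (real CARD('n) - 1) \<longrightarrow>
            bergman_space (domD a m) =
              cspan {(\<lambda>z. if z \<in> domD a m then monomial_n p z else 0) | p.
                       real (mi_length p) < (real CARD('n) - 1) * a - 1})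
       \<and> (a \<le> 1 / (real CARD('n) - 1) \<longrightarrow> bergman_space (domD a m) = {(\<lambda>z. 0)})
       \<and> (\<forall>k::nat. (real k + 1) / (real CARD('n) - 1) < a \<and> a \<le> (real k + 2) / (real CARD('n) - 1)
              \<longrightarrow> cdim (bergman_space (domD a m)) = (CARD('n) + k) choose k)"
proof (intro conjI allI impI)
  have pos: "0 < real CARD('n) - 1" using n2 by simp
  note span = bergman_space_domD_eq_span[OF apos, of m]
  show "bergman_space (domD a m) =
      cspan {(\<lambda>z. if z \<in> domD a m then monomial_n p z else 0) | p.
               real (mi_length p) < (real CARD('n) - 1) * a - 1}"
    using span unfolding restr_def .
  show "bergman_space (domD a m) = {(\<lambda>z. 0)}" if "a \<le> 1 / (real CARD('n) - 1)"
  proof -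
    \<comment> \<open>The bound (n - 1) a - 1 is then at most 0, and no length lies strictly below
      it, so the generating set is empty.\<close>
    have "(real CARD('n) - 1) * a \<le> 1" using that pos by (simp add: field_simps)
    then have e: "{restr (domD a m) (monomial_n p) | p. real (mi_length p) < (real CARD('n) - 1) * a - 1} = {}"
      by auto
    show ?thesis unfolding span e fs.span_empty by (simp add: zero_fun_def)
  qed
  fix k :: nat
  assume k: "(real k + 1) / (real CARD('n) - 1) < a \<and> a \<le> (real k + 2) / (real CARD('n) - 1)"
  \<comment> \<open>The half-open range of \<open>a\<close> puts (n - 1) a - 1 into the interval
    from k, excluded, to k + 1, included. The strict inequality on |p| therefore selects exactly |p|
    \<le> k.\<close>
  have b: "real k < (real CARD('n) - 1) * a - 1" "(real CARD('n) - 1) * a - 1 \<le> real k + 1"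
    using k pos by (auto simp: field_simps)
  have "real j < (real CARD('n) - 1) * a - 1 \<longleftrightarrow> j \<le> k" for j
    using b by linarith
  then show "cdim (bergman_space (domD a m)) = (CARD('n) + k) choose k"
    unfolding span by (simp only: cdim_span_restr_monomial_n)
qed


end
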